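(* Let $\mathbb{K}$ be a field, let $\Lambda=(\mathfrak{C},G_\sigma,\psi_a,g_{a,b})$ be a complex of groups over a scwol $\mathfrak{C}$, and let $\mathcal{C}\Lambda$ be its B.H. category. Then the following are equivalent: (i) there is a $\mathbb{K}$-vector space $V$ such that the group $\mathrm{GL}(V)$ is a witness to the developability of $\Lambda$; (ii) there exists a sheaf $\mathcal{F}:\mathcal{C}\Lambda\to\mathbb{K}\text{-Vect}$ over $\mathcal{C}\Lambda$ satisfying the dev properties.
   Context: **Scwols.** A scwol $\mathfrak{C}$ is a small category such that every morphism with equal initial and terminal object is an identity, and such that if $a,b$ are composable non-identity morphisms then $i(ab)\neq t(ab)$. $\mathrm{Obj}(\mathfrak{C})$ is the set of objects, $\mathrm{Mor}(\mathfrak{C})$ the set of all morphisms, and $\mathrm{Arr}(\mathfrak{C})$ the set of non-identity morphisms. For a morphism $a$, $i(a)$ and $t(a)$ denote its initial and terminal objects; $ab$ is defined when $i(a)=t(b)$, and then $i(ab)=i(b)$, $t(ab)=t(a)$. **Complexes of groups.** A complex of groups $\Lambda=(\mathfrak{C},G_\sigma,\psi_a,g_{a,b})$ consists of a scwol $\mathfrak{C}$; a group $G_\sigma$ (local group) for each $\sigma\in\mathrm{Obj}(\mathfrak{C})$; an injective homomorphism $\psi_a:G_{i(a)}\to G_{t(a)}$ for each $a\in\mathrm{Arr}(\mathfrak{C})$; and an element $g_{a,b}\in G_{t(a)}$ for each composable pair $a,b\in\mathrm{Arr}(\mathfrak{C})$ with $i(a)=t(b)$, such that $\mathrm{Ad}(g_{a,b})\psi_{ab}=\psi_a\psi_b$,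 where $\mathrm{Ad}(g)(x)=gxg^{-1}$, and $\psi_a(g_{b,c})g_{a,bc}=g_{a,b}g_{ab,c}$ for every composable triple $(a,b,c)$. By convention $\psi_\alpha$ is the identity if $\alpha$ is an identity morphism, and $g_{\alpha,\beta}=1$ if $\alpha$ or $\beta$ is an identity morphism. **B.H. category.** $\mathcal{C}\Lambda$ has objects $\mathrm{Obj}(\mathfrak{C})$ and morphisms the pairs $(g,\alpha)$ with $\alpha\in\mathrm{Mor}(\mathfrak{C})$, $g\in G_{t(\alpha)}$, where $(g,\alpha)$ goes from $i(\alpha)$ to $t(\alpha)$. Composition, when $i(\alpha)=t(\beta)$, is $(g,\alpha)(h,\beta)=(g\,\psi_\alpha(h)\,g_{\alpha,\beta},\,\alpha\beta)$. For an object $\sigma$, $\mathbb{1}_\sigma$ denotes the identity morphism of $\sigma$ in $\mathfrak{C}$, and $S_\sigma$ denotes the full subcategory of $\mathcal{C}\Lambda$ on the single object $\sigma$; its morphisms are exactly the $(g,\mathbb{1}_\sigma)$ with $g\in G_\sigma$. **Morphisms to a group, witnesses.** For a group $G$, $\Theta(G)$ is the complex of groups over the scwol with one object and no non-identity morphisms, with local group $G$. A morphism $\phi=(\phi_\sigma,\phi(a)):\Lambda\to\Theta(G)$ consists of a homomorphism $\phi_\sigma:G_\sigma\to G$ for each $\sigma\in\mathrm{Obj}(\mathfrak{C})$ and an element $\phi(a)\in G$ for each $a\in\mathrm{Arr}(\mathfrak{C})$ such that $\phi_{t(a)}\psi_a=\mathrm{Ad}(\phi(a))\phi_{i(a)}$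 for all $a$, and $\phi_{t(a)}(g_{a,b})\phi(ab)=\phi(a)\phi(b)$ for all composable $a,b\in\mathrm{Arr}(\mathfrak{C})$. It is injective on local groups if every $\phi_\sigma$ is injective. $\Lambda$ is developable if it is isomorphic to a complex of groups associated to an action of a group on a scwol $\mathcal{X}$, with $\mathfrak{C}$ the quotient scwol; by a theorem of Bridson and Haefliger, this holds if and only if there exist a group $G$ and a morphism $\Lambda\to\Theta(G)$ that is injective on local groups. A group $G$ is a witness to (witnesses) the developability of $\Lambda$ if $\Lambda$ is developable and there exists a morphism $\phi:\Lambda\to\Theta(G)$ that is injective on local groups. **Sheaves.** $\mathbb{K}\text{-Vect}$ is the category of $\mathbb{K}$-vector spaces, and $\mathrm{GL}(V)$ is the general linear group of the vector space $V$. A sheaf over a category $\mathcal{D}$ is a (covariant) functor $\mathcal{F}:\mathcal{D}\to\mathbb{K}\text{-Vect}$. A sheaf $\mathcal{F}$ over $\mathcal{C}\Lambda$ satisfies the dev properties if: (1) it has constant rank, i.e. there is $n\in\mathbb{N}$ with $\dim\mathcal{F}(\sigma)=n$ for every object $\sigma$; (2) $\mathcal{F}(\lambda)$ is invertible for every morphism $\lambda$ of $\mathcal{C}\Lambda$; (3) it is injective on local groups, i.e. for every object $\sigma$ the restriction $\mathcal{F}|_{S_\sigma}$ is injective on morphisms, i.e. $\mathcal{F}((g,\mathbb{1}_\sigma))=\mathcal{F}((h,\mathbb{1}_\sigma))$ implies $g=h$.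
   Formalization: In (i) the vector space V is required to be finite-dimensional; with infinite-dimensional V the claim fails, e.g. for one local group G acting faithfully on K[G] but having no faithful finite-dimensional representation over K, since the dev properties demand finite rank n. *)

theory Defs
  imports "HOL-Algebra.Group_Action" "Jordan_Normal_Form.Missing_VectorSpace"
begin

section \<open>Small categories and scwols\<close>

text \<open>
  \<open>a \<cdot>\<^bsub>C\<^esub> b\<close> is ``first \<open>b\<close>, then \<open>a\<close>''; it is meaningful only when \<open>ini C a = ter C b\<close>.
\<close>

record ('o, 'm) precategory =
  Obj :: "'o set"
  Mor :: "'m set"
  ini :: "'m \<Rightarrow> 'o"
  ter :: "'m \<Rightarrow> 'o"
  Idn :: "'o \<Rightarrow> 'm"
  cmp :: "'m \<Rightarrow> 'm \<Rightarrow> 'm" (infixl \<open>\<cdot>\<index>\<close> 70)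

locale category =
  fixes C :: "('o, 'm) precategory" (structure)
  assumes ini_closed: "a \<in> Mor C \<Longrightarrow> ini C a \<in> Obj C"
    and ter_closed: "a \<in> Mor C \<Longrightarrow> ter C a \<in> Obj C"
    and Idn_closed: "x \<in> Obj C \<Longrightarrow> Idn C x \<in> Mor C"
    and ini_Idn: "x \<in> Obj C \<Longrightarrow> ini C (Idn C x) = x"
    and ter_Idn: "x \<in> Obj C \<Longrightarrow> ter C (Idn C x) = x"
    and cmp_closed: "\<lbrakk>a \<in> Mor C; b \<in> Mor C; ini C a = ter C b\<rbrakk> \<Longrightarrow> a \<cdot> b \<in> Mor C"
    and ini_cmp: "\<lbrakk>a \<in> Mor C; b \<in> Mor C; ini C a = ter C b\<rbrakk> \<Longrightarrow> ini C (a \<cdot> b) = ini C b"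
    and ter_cmp: "\<lbrakk>a \<in> Mor C; b \<in> Mor C; ini C a = ter C b\<rbrakk> \<Longrightarrow> ter C (a \<cdot> b) = ter C a"
    and cmp_assoc: "\<lbrakk>a \<in> Mor C; b \<in> Mor C; c \<in> Mor C; ini C a = ter C b; ini C b = ter C c\<rbrakk>
      \<Longrightarrow> (a \<cdot> b) \<cdot> c = a \<cdot> (b \<cdot> c)"
    and Idn_left: "a \<in> Mor C \<Longrightarrow> Idn C (ter C a) \<cdot> a = a"
    and Idn_right: "a \<in> Mor C \<Longrightarrow> a \<cdot> Idn C (ini C a) = a"

definition Arr :: "('o, 'm) precategory \<Rightarrow> 'm set"
  where "Arr C = Mor C - Idn C ` Obj C"

locale scwol = category +
  assumes no_loops: "\<lbrakk>a \<in> Mor C; ini C a = ter C a\<rbrakk> \<Longrightarrow> a = Idn C (ini C a)"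
    and no_cycles: "\<lbrakk>a \<in> Arr C; b \<in> Arr C; ini C a = ter C b\<rbrakk> \<Longrightarrow> ini C (a \<cdot> b) \<noteq> ter C (a \<cdot> b)"

definition category_iso ::
    "('o, 'm) precategory \<Rightarrow> ('p, 'q) precategory \<Rightarrow> ('o \<Rightarrow> 'p) \<Rightarrow> ('m \<Rightarrow> 'q) \<Rightarrow> bool"
  where "category_iso C D fo fm \<longleftrightarrow>
    bij_betw fo (Obj C) (Obj D) \<and> bij_betw fm (Mor C) (Mor D) \<and>
    (\<forall>a\<in>Mor C. ini D (fm a) = fo (ini C a) \<and> ter D (fm a) = fo (ter C a)) \<and>
    (\<forall>x\<in>Obj C. fm (Idn C x) = Idn D (fo x)) \<and>
    (\<forall>a\<in>Mor C. \<forall>b\<in>Mor C. ini C a = ter C b \<longrightarrow> fm (a \<cdot>\<^bsub>C\<^esub> b) = fm a \<cdot>\<^bsub>D\<^esub> fm b)"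


section \<open>Complexes of groups\<close>

text \<open>
  The data \<open>psi\<close> and \<open>twist\<close> are relevant on \<open>Arr\<close> only; the convention that extends them to
  identity morphisms is \<open>psi_ext\<close> and \<open>twist_ext\<close> below.
\<close>

record ('o, 'm, 'g) complex_of_groups_data =
  base :: "('o, 'm) precategory"
  lgrp :: "'o \<Rightarrow> 'g monoid"
  psi :: "'m \<Rightarrow> 'g \<Rightarrow> 'g"
  twist :: "'m \<Rightarrow> 'm \<Rightarrow> 'g"

definition Ad :: "('g, 'x) monoid_scheme \<Rightarrow> 'g \<Rightarrow> 'g \<Rightarrow> 'g"
  where "Ad G g x = g \<otimes>\<^bsub>G\<^esub> x \<otimes>\<^bsub>G\<^esub> inv\<^bsub>G\<^esub> g"

locale complex_of_groups =
  fixes \<Lambda> :: "('o, 'm, 'g) complex_of_groups_data"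
    and C :: "('o, 'm) precategory" (structure)
  defines "C \<equiv> base \<Lambda>"
  assumes scwol_base: "scwol C"
    and lgrp_group: "x \<in> Obj C \<Longrightarrow> group (lgrp \<Lambda> x)"
    and psi_mon: "a \<in> Arr C \<Longrightarrow> psi \<Lambda> a \<in> mon (lgrp \<Lambda> (ini C a)) (lgrp \<Lambda> (ter C a))"
    and twist_closed: "\<lbrakk>a \<in> Arr C; b \<in> Arr C; ini C a = ter C b\<rbrakk>
      \<Longrightarrow> twist \<Lambda> a b \<in> carrier (lgrp \<Lambda> (ter C a))"
    and Ad_twist: "\<lbrakk>a \<in> Arr C; b \<in> Arr C; ini C a = ter C b; g \<in> carrier (lgrp \<Lambda> (ini C b))\<rbrakk>
      \<Longrightarrow> Ad (lgrp \<Lambda> (ter C a)) (twist \<Lambda> a b) (psi \<Lambda> (a \<cdot> b) g) = psi \<Lambda> a (psi \<Lambda> b g)"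
    and cocycle: "\<lbrakk>a \<in> Arr C; b \<in> Arr C; c \<in> Arr C; ini C a = ter C b; ini C b = ter C c\<rbrakk>
      \<Longrightarrow> psi \<Lambda> a (twist \<Lambda> b c) \<otimes>\<^bsub>lgrp \<Lambda> (ter C a)\<^esub> twist \<Lambda> a (b \<cdot> c)
        = twist \<Lambda> a b \<otimes>\<^bsub>lgrp \<Lambda> (ter C a)\<^esub> twist \<Lambda> (a \<cdot> b) c"

definition psi_ext :: "('o, 'm, 'g) complex_of_groups_data \<Rightarrow> 'm \<Rightarrow> 'g \<Rightarrow> 'g"
  where "psi_ext \<Lambda> \<alpha> = (if \<alpha> \<in> Arr (base \<Lambda>) then psi \<Lambda> \<alpha> else id)"

definition twist_ext :: "('o, 'm, 'g) complex_of_groups_data \<Rightarrow> 'm \<Rightarrow> 'm \<Rightarrow> 'g"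
  where "twist_ext \<Lambda> \<alpha> \<beta> = (if \<alpha> \<in> Arr (base \<Lambda>) \<and> \<beta> \<in> Arr (base \<Lambda>) then twist \<Lambda> \<alpha> \<beta>
    else \<one>\<^bsub>lgrp \<Lambda> (ter (base \<Lambda>) \<alpha>)\<^esub>)"

definition BH_category :: "('o, 'm, 'g) complex_of_groups_data \<Rightarrow> ('o, 'g \<times> 'm) precategory"
  where "BH_category \<Lambda> =
    \<lparr>Obj = Obj (base \<Lambda>),
     Mor = {(g, \<alpha>). \<alpha> \<in> Mor (base \<Lambda>) \<and> g \<in> carrier (lgrp \<Lambda> (ter (base \<Lambda>) \<alpha>))},
     ini = (\<lambda>(g, \<alpha>). ini (base \<Lambda>) \<alpha>),
     ter = (\<lambda>(g, \<alpha>). ter (base \<Lambda>) \<alpha>),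
     Idn = (\<lambda>\<sigma>. (\<one>\<^bsub>lgrp \<Lambda> \<sigma>\<^esub>, Idn (base \<Lambda>) \<sigma>)),
     cmp = (\<lambda>(g, \<alpha>) (h, \<beta>).
       (g \<otimes>\<^bsub>lgrp \<Lambda> (ter (base \<Lambda>) \<alpha>)\<^esub> psi_ext \<Lambda> \<alpha> h \<otimes>\<^bsub>lgrp \<Lambda> (ter (base \<Lambda>) \<alpha>)\<^esub> twist_ext \<Lambda> \<alpha> \<beta>,
        \<alpha> \<cdot>\<^bsub>base \<Lambda>\<^esub> \<beta>))\<rparr>"

text \<open>
  Isomorphism of complexes of groups in the sense of Bridson and Haefliger: a morphism
  \<open>(fo, fm, \<phi>, \<phi>a)\<close> over an isomorphism of scwols all of whose local homomorphisms are isomorphisms.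
\<close>

definition complex_iso ::
    "('o, 'm, 'g) complex_of_groups_data \<Rightarrow> ('p, 'q, 'h) complex_of_groups_data \<Rightarrow>
     ('o \<Rightarrow> 'p) \<Rightarrow> ('m \<Rightarrow> 'q) \<Rightarrow> ('o \<Rightarrow> 'g \<Rightarrow> 'h) \<Rightarrow> ('m \<Rightarrow> 'h) \<Rightarrow> bool"
  where "complex_iso \<Lambda> \<Lambda>' fo fm \<phi> \<phi>a \<longleftrightarrow>
    (let C = base \<Lambda>; G = lgrp \<Lambda>; G' = (\<lambda>\<sigma>. lgrp \<Lambda>' (fo \<sigma>)) in
      category_iso C (base \<Lambda>') fo fm \<and>
      (\<forall>\<sigma>\<in>Obj C. \<phi> \<sigma> \<in> iso (G \<sigma>) (G' \<sigma>)) \<and>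
      (\<forall>a\<in>Arr C. \<phi>a a \<in> carrier (G' (ter C a))) \<and>
      (\<forall>a\<in>Arr C. \<forall>g\<in>carrier (G (ini C a)).
         Ad (G' (ter C a)) (\<phi>a a) (psi \<Lambda>' (fm a) (\<phi> (ini C a) g)) = \<phi> (ter C a) (psi \<Lambda> a g)) \<and>
      (\<forall>a\<in>Arr C. \<forall>b\<in>Arr C. ini C a = ter C b \<longrightarrow>
         \<phi> (ter C a) (twist \<Lambda> a b) \<otimes>\<^bsub>G' (ter C a)\<^esub> \<phi>a (a \<cdot>\<^bsub>C\<^esub> b)
         = \<phi>a a \<otimes>\<^bsub>G' (ter C a)\<^esub> psi \<Lambda>' (fm a) (\<phi>a b) \<otimes>\<^bsub>G' (ter C a)\<^esub> twist \<Lambda>' (fm a) (fm b)))"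


section \<open>Group actions on scwols and developability\<close>

text \<open>
  A group action on a scwol in the sense of Bridson and Haefliger: a homomorphism to the
  automorphism group (\<open>ao\<close> on objects, \<open>am\<close> on morphisms) such that no arrow joins two objects of
  the same orbit and such that an element fixing \<open>ini X a\<close> fixes \<open>a\<close>.
\<close>

locale scwol_action = scwol X
  for H :: "'h monoid" and X :: "('p, 'q) precategory" (structure)
    and ao :: "'h \<Rightarrow> 'p \<Rightarrow> 'p" and am :: "'h \<Rightarrow> 'q \<Rightarrow> 'q" +
  assumes act_Obj: "group_action H (Obj X) ao"
    and act_Mor: "group_action H (Mor X) am"
    and act_category_iso: "h \<in> carrier H \<Longrightarrow> category_iso X X (ao h) (am h)"
    and act_no_inversion: "\<lbrakk>h \<in> carrier H; a \<in> Arr X\<rbrakk> \<Longrightarrow> ao h (ini X a) \<noteq> ter X a"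
    and act_fixes: "\<lbrakk>h \<in> carrier H; a \<in> Arr X; ao h (ini X a) = ini X a\<rbrakk> \<Longrightarrow> am h a = a"

text \<open>
  Objects and morphisms of the quotient are orbits. The image of an orbit under an equivariant map
  is an orbit, so the initial object of \<open>A\<close> is \<open>ini X ` A\<close>, and so on; the composite of two orbits
  consists of all composites of composable representatives.
\<close>

definition quotient_scwol ::
    "'h monoid \<Rightarrow> ('p, 'q) precategory \<Rightarrow> ('h \<Rightarrow> 'p \<Rightarrow> 'p) \<Rightarrow> ('h \<Rightarrow> 'q \<Rightarrow> 'q)
     \<Rightarrow> ('p set, 'q set) precategory"
  where "quotient_scwol H X ao am =
    \<lparr>Obj = orbits H (Obj X) ao,
     Mor = orbits H (Mor X) am,
     ini = (\<lambda>A. ini X ` A),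
     ter = (\<lambda>A. ter X ` A),
     Idn = (\<lambda>S. Idn X ` S),
     cmp = (\<lambda>A B. {a \<cdot>\<^bsub>X\<^esub> b | a b. a \<in> A \<and> b \<in> B \<and> ini X a = ter X b})\<rparr>"

text \<open>
  Choices entering the complex of groups associated to an action: a representative \<open>lo \<sigma>\<close> of each
  object of the quotient, for each arrow \<open>a\<close> its representative \<open>lm a\<close> starting at
  \<open>lo (ini a)\<close>, and an element \<open>k a\<close> carrying the end point of \<open>lm a\<close> to \<open>lo (ter a)\<close>.
\<close>

locale action_choices = scwol_action H X ao am
  for H :: "'h monoid" and X :: "('p, 'q) precategory" (structure)
    and ao :: "'h \<Rightarrow> 'p \<Rightarrow> 'p" and am :: "'h \<Rightarrow> 'q \<Rightarrow> 'q" +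
  fixes lo :: "'p set \<Rightarrow> 'p" and lm :: "'q set \<Rightarrow> 'q" and k :: "'q set \<Rightarrow> 'h"
    and Y :: "('p set, 'q set) precategory"
  defines "Y \<equiv> quotient_scwol H X ao am"
  assumes lo: "\<sigma> \<in> Obj Y \<Longrightarrow> lo \<sigma> \<in> \<sigma>"
    and lm: "a \<in> Arr Y \<Longrightarrow> lm a \<in> a"
    and lm_ini: "a \<in> Arr Y \<Longrightarrow> ini X (lm a) = lo (ini Y a)"
    and k: "a \<in> Arr Y \<Longrightarrow> k a \<in> carrier H"
    and k_ter: "a \<in> Arr Y \<Longrightarrow> ao (k a) (ter X (lm a)) = lo (ter Y a)"

definition associated_complex ::
    "'h monoid \<Rightarrow> ('p, 'q) precategory \<Rightarrow> ('h \<Rightarrow> 'p \<Rightarrow> 'p) \<Rightarrow> ('h \<Rightarrow> 'q \<Rightarrow> 'q)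
     \<Rightarrow> ('p set \<Rightarrow> 'p) \<Rightarrow> ('q set \<Rightarrow> 'h) \<Rightarrow> ('p set, 'q set, 'h) complex_of_groups_data"
  where "associated_complex H X ao am lo k =
    \<lparr>base = quotient_scwol H X ao am,
     lgrp = (\<lambda>\<sigma>. H\<lparr>carrier := stabilizer H ao (lo \<sigma>)\<rparr>),
     psi = (\<lambda>a. Ad H (k a)),
     twist = (\<lambda>a b. k a \<otimes>\<^bsub>H\<^esub> k b \<otimes>\<^bsub>H\<^esub> inv\<^bsub>H\<^esub> (k (a \<cdot>\<^bsub>quotient_scwol H X ao am\<^esub> b)))\<rparr>"

text \<open>
  The argument fixes the type \<open>'h\<close> in which the acting group lives, since types cannot be
  quantified over. Given \<open>'h\<close>, the types chosen for \<open>X\<close> lose no generality: over an object \<open>\<sigma>\<close> of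
  the quotient the objects of \<open>X\<close> are the cosets of a stabilizer, and likewise for morphisms.
\<close>

definition developable :: "'h itself \<Rightarrow> ('o, 'm, 'g) complex_of_groups_data \<Rightarrow> bool"
  where "developable T \<Lambda> \<longleftrightarrow>
    (\<exists>(H :: 'h monoid) (X :: ('h set \<times> 'o, 'h set \<times> 'm) precategory) ao am lo lm k.
       action_choices H X ao am lo lm k \<and>
       (\<exists>fo fm \<phi> \<phi>a. complex_iso \<Lambda> (associated_complex H X ao am lo k) fo fm \<phi> \<phi>a))"


section \<open>Morphisms to a group and witnesses\<close>

text \<open>
  A morphism from \<open>\<Lambda>\<close> to the complex of groups over the one-object scwol with local group \<open>G\<close>.
\<close>

locale morphism_to_group = group G
  for \<Lambda> :: "('o, 'm, 'g) complex_of_groups_data" and G :: "'h monoid" (structure)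
    and \<phi> :: "'o \<Rightarrow> 'g \<Rightarrow> 'h" and \<phi>a :: "'m \<Rightarrow> 'h"
    and C :: "('o, 'm) precategory" +
  defines "C \<equiv> base \<Lambda>"
  assumes hom: "\<sigma> \<in> Obj C \<Longrightarrow> \<phi> \<sigma> \<in> hom (lgrp \<Lambda> \<sigma>) G"
    and arr_closed: "a \<in> Arr C \<Longrightarrow> \<phi>a a \<in> carrier G"
    and arr_conj: "\<lbrakk>a \<in> Arr C; g \<in> carrier (lgrp \<Lambda> (ini C a))\<rbrakk>
      \<Longrightarrow> \<phi> (ter C a) (psi \<Lambda> a g) = Ad G (\<phi>a a) (\<phi> (ini C a) g)"
    and arr_cmp: "\<lbrakk>a \<in> Arr C; b \<in> Arr C; ini C a = ter C b\<rbrakk>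
      \<Longrightarrow> \<phi> (ter C a) (twist \<Lambda> a b) \<otimes> \<phi>a (a \<cdot>\<^bsub>C\<^esub> b) = \<phi>a a \<otimes> \<phi>a b"

definition injective_on_local_groups ::
    "('o, 'm, 'g) complex_of_groups_data \<Rightarrow> ('o \<Rightarrow> 'g \<Rightarrow> 'h) \<Rightarrow> bool"
  where "injective_on_local_groups \<Lambda> \<phi> \<longleftrightarrow>
    (\<forall>\<sigma>\<in>Obj (base \<Lambda>). inj_on (\<phi> \<sigma>) (carrier (lgrp \<Lambda> \<sigma>)))"

text \<open>
  Given a morphism to \<open>G\<close> that is injective on local groups, \<open>G\<close> itself acts on the associated
  development, so testing developability with groups in the type of \<open>G\<close> is no restriction here.
\<close>

definition witnesses :: "'h monoid \<Rightarrow> ('o, 'm, 'g) complex_of_groups_data \<Rightarrow> bool"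
  where "witnesses G \<Lambda> \<longleftrightarrow> developable TYPE('h) \<Lambda> \<and>
    (\<exists>\<phi> \<phi>a. morphism_to_group \<Lambda> G \<phi> \<phi>a \<and> injective_on_local_groups \<Lambda> \<phi>)"


section \<open>Vector spaces and sheaves\<close>

text \<open>
  As for \<^const>\<open>BijGroup\<close>, linear maps are taken to be extensional, so that equality of functions is
  equality of linear maps.
\<close>

definition Lin :: "('k, 'r) ring_scheme \<Rightarrow> ('k, 'v) module \<Rightarrow> ('k, 'w) module \<Rightarrow> ('v \<Rightarrow> 'w) set"
  where "Lin K V W = module_hom K V W \<inter> extensional (carrier V)"

definition Lin_invertible ::
    "('k, 'r) ring_scheme \<Rightarrow> ('k, 'v) module \<Rightarrow> ('k, 'w) module \<Rightarrow> ('v \<Rightarrow> 'w) \<Rightarrow> bool"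
  where "Lin_invertible K V W f \<longleftrightarrow>
    (\<exists>g\<in>Lin K W V. compose (carrier V) g f = (\<lambda>v\<in>carrier V. v) \<and>
                   compose (carrier W) f g = (\<lambda>w\<in>carrier W. w))"

definition GL :: "('k, 'r) ring_scheme \<Rightarrow> ('k, 'v) module \<Rightarrow> ('v \<Rightarrow> 'v) monoid"
  where "GL K V = BijGroup (carrier V) \<lparr>carrier := module_hom K V V \<inter> Bij (carrier V)\<rparr>"

locale sheaf =
  fixes K :: "('k, 'r) ring_scheme"
    and D :: "('o, 'm) precategory"
    and Fo :: "'o \<Rightarrow> ('k, 'v) module"
    and Fm :: "'m \<Rightarrow> 'v \<Rightarrow> 'v"
  assumes vectorspace: "x \<in> Obj D \<Longrightarrow> vectorspace K (Fo x)"
    and Lin: "l \<in> Mor D \<Longrightarrow> Fm l \<in> Lin K (Fo (ini D l)) (Fo (ter D l))"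
    and map_Idn: "x \<in> Obj D \<Longrightarrow> Fm (Idn D x) = (\<lambda>v\<in>carrier (Fo x). v)"
    and map_cmp: "\<lbrakk>l \<in> Mor D; m \<in> Mor D; ini D l = ter D m\<rbrakk>
      \<Longrightarrow> Fm (l \<cdot>\<^bsub>D\<^esub> m) = compose (carrier (Fo (ini D m))) (Fm l) (Fm m)"

text \<open>
  Finite-dimensionality is stated separately in (1), since \<^const>\<open>vectorspace.dim\<close> is unspecified
  for a space that is not finite-dimensional.
\<close>

definition dev_properties ::
    "('k, 'r) ring_scheme \<Rightarrow> ('o, 'm, 'g) complex_of_groups_data \<Rightarrow>
     ('o \<Rightarrow> ('k, 'v) module) \<Rightarrow> ('g \<times> 'm \<Rightarrow> 'v \<Rightarrow> 'v) \<Rightarrow> bool"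
  where "dev_properties K \<Lambda> Fo Fm \<longleftrightarrow>
    (let D = BH_category \<Lambda> in
      (\<exists>n. \<forall>\<sigma>\<in>Obj D. vectorspace.fin_dim K (Fo \<sigma>) \<and> vectorspace.dim K (Fo \<sigma>) = n) \<and>
      (\<forall>l\<in>Mor D. Lin_invertible K (Fo (ini D l)) (Fo (ter D l)) (Fm l)) \<and>
      (\<forall>\<sigma>\<in>Obj D. inj_on Fm {l \<in> Mor D. ini D l = \<sigma> \<and> ter D l = \<sigma>}))"

end

theory Submission
  imports Defs
begin

text \<open>
  Both sides of the equivalence are ways of saying that the B.H. category of \<open>\<Lambda>\<close> has a
  representation on a single finite-dimensional space which is faithful on each vertex group.

  A morphism \<open>\<phi>\<close> from \<open>\<Lambda>\<close> to a group \<open>G\<close> is the same thing as a functor \<open>\<Phi>\<close> from the B.H. category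
  to \<open>G\<close>: put \<open>\<Phi> (g, \<alpha>) = \<phi> g \<cdot> \<phi> \<alpha>\<close> in one direction, and restrict \<open>\<Phi>\<close> to the morphisms
  \<open>(g, 1)\<close> and \<open>(1, a)\<close> in the other (\<open>functor_BH_category\<close>, \<open>functor_imp_morphism\<close>). Since a scwol has
  no loops, the endomorphisms of an object \<open>\<sigma>\<close> of the B.H. category are just the \<open>(g, 1)\<close> with \<open>g\<close> in
  the local group at \<open>\<sigma>\<close>, so injectivity on local groups means the same for \<open>\<phi>\<close> and for \<open>\<Phi>\<close>.

  For \<open>G = GL(V)\<close>, a functor to \<open>G\<close> is a sheaf with constant value \<open>V\<close> and invertible maps, so a
  witness of the form \<open>GL(V)\<close> gives a sheaf (\<open>witness_imp_sheaf\<close>). Conversely, a sheaf of constant finite rank takes values in spaces that are all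
  isomorphic to one \<open>V\<close>, and conjugating by a choice of isomorphisms, one for each object, turns it
  into a functor to \<open>GL(V)\<close> (\<open>functor_of_sheaf\<close>). The isomorphisms must be chosen by dimension rather
  than transported along arrows, because the scwol may be disconnected.

  What remains is that a morphism \<open>\<phi>\<close> to \<open>G\<close> that is injective on local groups makes \<open>\<Lambda>\<close> developable.
  This is the theorem of Bridson and Haefliger, and it is proved by writing down the development: over
  an object \<open>\<sigma>\<close> lie the left cosets of the image of the local group at \<open>\<sigma>\<close>, over an arrow the left
  cosets of the image of the local group at its source, and \<open>G\<close> acts by left translation. The quotient
  is the given scwol, the stabilizer of the trivial coset is the image of the local group, which is a
  copy of the local group by injectivity, and the elements \<open>\<phi> a\<close> serve as the choices that enter the
  associated complex (\<open>action_choices_development\<close>, \<open>injective_imp_developable\<close>).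
\<close>

section \<open>General linear groups and isomorphisms of vector spaces\<close>

lemma module_hom_compose:
  assumes U: "module K U" and f: "f \<in> module_hom K V W" and g: "g \<in> module_hom K U V"
  shows "compose (carrier U) f g \<in> module_hom K U W"
proof -
  interpret U: module K U by fact
  show ?thesis
    using f g by (auto simp: module_hom_def compose_def Pi_iff)
qed

lemma module_hom_inv_into:
  assumes V: "module K V" and f: "f \<in> module_hom K V W" and bij: "bij_betw f (carrier V) (carrier W)"
  shows "(\<lambda>w\<in>carrier W. inv_into (carrier V) f w) \<in> module_hom K W V"
proof -
  interpret V: module K V by fact
  let ?g = "inv_into (carrier V) f"
  have inj: "inj_on f (carrier V)" and surj: "f ` carrier V = carrier W"
    using bij by (auto simp: bij_betw_def)
  have g: "?g w \<in> carrier V" "f (?g w) = w" if "w \<in> carrier W" for w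
    using that surj inv_into_into[of w f] f_inv_into_f[of w f] by auto
  have add: "x \<oplus>\<^bsub>W\<^esub> y \<in> carrier W \<and> ?g (x \<oplus>\<^bsub>W\<^esub> y) = ?g x \<oplus>\<^bsub>V\<^esub> ?g y"
    if "x \<in> carrier W" "y \<in> carrier W" for x y
  proof -
    have "f (?g x \<oplus>\<^bsub>V\<^esub> ?g y) = x \<oplus>\<^bsub>W\<^esub> y"
      using f g that by (simp add: module_hom_add)
    moreover have "?g x \<oplus>\<^bsub>V\<^esub> ?g y \<in> carrier V"
      using g that by simp
    ultimately show ?thesis
      using inj surj by (metis image_eqI inv_into_f_f)
  qed
  have smult: "c \<odot>\<^bsub>W\<^esub> x \<in> carrier W \<and> ?g (c \<odot>\<^bsub>W\<^esub> x) = c \<odot>\<^bsub>V\<^esub> ?g x"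
    if "c \<in> carrier K" "x \<in> carrier W" for c x
  proof -
    have "f (c \<odot>\<^bsub>V\<^esub> ?g x) = c \<odot>\<^bsub>W\<^esub> x"
      using f g that by (simp add: module_hom_smult)
    moreover have "c \<odot>\<^bsub>V\<^esub> ?g x \<in> carrier V"
      using g that by simp
    ultimately show ?thesis
      using inj surj by (metis image_eqI inv_into_f_f)
  qed
  show ?thesis
    using g add smult by (auto simp: module_hom_def)
qed

lemma GL_carrier: "carrier (GL K V) = module_hom K V V \<inter> Bij (carrier V)"
  by (simp add: GL_def)

lemma GL_one: "\<one>\<^bsub>GL K V\<^esub> = (\<lambda>v\<in>carrier V. v)"
  by (simp add: GL_def BijGroup_def)

lemma GL_mult:
  assumes "f \<in> carrier (GL K V)" and "g \<in> carrier (GL K V)"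
  shows "f \<otimes>\<^bsub>GL K V\<^esub> g = compose (carrier V) f g"
  using assms by (simp add: GL_def BijGroup_def)

lemma group_GL:
  assumes "module K V"
  shows "group (GL K V)"
proof -
  interpret V: module K V by fact
  interpret B: group "BijGroup (carrier V)" by (rule group_BijGroup)
  have "subgroup (module_hom K V V \<inter> Bij (carrier V)) (BijGroup (carrier V))"
  proof (rule B.subgroupI)
    show "module_hom K V V \<inter> Bij (carrier V) \<subseteq> carrier (BijGroup (carrier V))"
      by (auto simp: BijGroup_def)
    have "(\<lambda>v\<in>carrier V. v) \<in> module_hom K V V \<inter> Bij (carrier V)"
      by (auto simp: module_hom_def id_Bij)
    then show "module_hom K V V \<inter> Bij (carrier V) \<noteq> {}"
      by blast
  next
    fix f assume f: "f \<in> module_hom K V V \<inter> Bij (carrier V)"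
    then have "bij_betw f (carrier V) (carrier V)"
      by (simp add: Bij_def)
    with f have "(\<lambda>v\<in>carrier V. inv_into (carrier V) f v) \<in> module_hom K V V"
      using module_hom_inv_into[OF assms, of f V] by blast
    with f show "inv\<^bsub>BijGroup (carrier V)\<^esub> f \<in> module_hom K V V \<inter> Bij (carrier V)"
      using restrict_inv_into_Bij[of f "carrier V"] by (simp add: inv_BijGroup)
  next
    fix f g assume "f \<in> module_hom K V V \<inter> Bij (carrier V)" "g \<in> module_hom K V V \<inter> Bij (carrier V)"
    then show "f \<otimes>\<^bsub>BijGroup (carrier V)\<^esub> g \<in> module_hom K V V \<inter> Bij (carrier V)"
      using module_hom_compose[OF assms, of f V V g] by (simp add: BijGroup_def compose_Bij)
  qed
  then show ?thesis
    unfolding GL_def by (rule B.subgroup_imp_group)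
qed

lemma Lin_invertible_imp_bij_betw:
  assumes "f \<in> Lin K V W" and "Lin_invertible K V W f"
  shows "bij_betw f (carrier V) (carrier W)"
proof -
  obtain g where g: "g \<in> Lin K W V" and gf: "compose (carrier V) g f = (\<lambda>v\<in>carrier V. v)"
    and fg: "compose (carrier W) f g = (\<lambda>w\<in>carrier W. w)"
    using assms(2) by (auto simp: Lin_invertible_def)
  show ?thesis
  proof (rule bij_betw_byWitness[where f' = g])
    show "\<forall>v\<in>carrier V. g (f v) = v" using gf by (metis compose_eq restrict_apply')
    show "\<forall>w\<in>carrier W. f (g w) = w" using fg by (metis compose_eq restrict_apply')
    show "f ` carrier V \<subseteq> carrier W" using assms(1) by (auto simp: Lin_def module_hom_def)
    show "g ` carrier W \<subseteq> carrier V" using g by (auto simp: Lin_def module_hom_def)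
  qed
qed

lemma GL_subset_Lin: "carrier (GL K V) \<subseteq> Lin K V V"
  by (auto simp: GL_carrier Lin_def Bij_def)

lemma GL_imp_Lin_invertible:
  assumes "module K V" and "f \<in> carrier (GL K V)"
  shows "Lin_invertible K V V f"
proof -
  interpret G: group "GL K V" using assms(1) by (rule group_GL)
  have "compose (carrier V) (inv\<^bsub>GL K V\<^esub> f) f = (\<lambda>v\<in>carrier V. v)"
       "compose (carrier V) f (inv\<^bsub>GL K V\<^esub> f) = (\<lambda>v\<in>carrier V. v)"
    using G.l_inv[OF assms(2)] G.r_inv[OF assms(2)] assms(2) by (simp_all add: GL_mult GL_one)
  then show ?thesis
    using GL_subset_Lin assms(2) unfolding Lin_invertible_def by blast
qed

text \<open>
  A bijection between two bases of the same size induces the isomorphism: a vector is sent to the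
  linear combination with the same coefficients, taken in the other basis.
\<close>

lemma equal_dim_imp_isomorphic:
  assumes "vectorspace K V" and "vectorspace K W"
    and "vectorspace.fin_dim K V" and "vectorspace.fin_dim K W"
    and dim: "vectorspace.dim K V = vectorspace.dim K W"
  obtains f where "f \<in> module_hom K V W" and "bij_betw f (carrier V) (carrier W)"
proof -
  interpret V: vectorspace K V by fact
  interpret W: vectorspace K W by fact
  obtain A where A: "finite A" "V.basis A" using V.finite_basis_exists assms by blast
  obtain B where B: "finite B" "W.basis B" using W.finite_basis_exists assms by blast
  have AV: "A \<subseteq> carrier V" and BW: "B \<subseteq> carrier W"
    using A B by (simp_all add: V.basis_def W.basis_def)
  have "card A = card B"
    using V.dim_basis[OF A] W.dim_basis[OF B] dim by simp
  then obtain r where r: "bij_betw r B A"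
    using A B finite_same_card_bij by metis
  define s where "s = inv_into B r"
  have s: "bij_betw s A B" and sr: "\<And>b. b \<in> B \<Longrightarrow> s (r b) = b" and rs: "\<And>a. a \<in> A \<Longrightarrow> r (s a) = a"
    unfolding s_def using r bij_betw_inv_into[OF r]
    by (auto simp: bij_betw_inv_into_left bij_betw_inv_into_right)
  have rB: "\<And>b. b \<in> B \<Longrightarrow> r b \<in> A" and sA: "\<And>a. a \<in> A \<Longrightarrow> s a \<in> B"
    using r s by (auto simp: bij_betw_def)
  have uniqV: "\<exists>!a. a \<in> A \<rightarrow>\<^sub>E carrier K \<and> V.lincomb a A = v" if "v \<in> carrier V" for v
    using V.basis_criterion[OF A(1) AV] A(2) that by blast
  have uniqW: "\<exists>!a. a \<in> B \<rightarrow>\<^sub>E carrier K \<and> W.lincomb a B = w" if "w \<in> carrier W" for w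
    using W.basis_criterion[OF B(1) BW] B(2) that by blast
  \<comment> \<open>Coefficients are made unique by taking them extensional on \<open>A\<close>, hence the restrictions below.\<close>
  define coord where "coord v = (THE a. a \<in> A \<rightarrow>\<^sub>E carrier K \<and> V.lincomb a A = v)" for v
  have coord: "coord v \<in> A \<rightarrow>\<^sub>E carrier K" "V.lincomb (coord v) A = v" if "v \<in> carrier V" for v
    using theI'[OF uniqV[OF that]] by (auto simp: coord_def)
  have coord_Pi: "coord v \<in> A \<rightarrow> carrier K" if "v \<in> carrier V" for v
    using coord(1)[OF that] by (simp add: PiE_iff Pi_iff)
  have coord_unique: "coord (V.lincomb a A) b = a b" if "a \<in> A \<rightarrow> carrier K" and "b \<in> A" for a b
  proof -
    have eq: "V.lincomb (restrict a A) A = V.lincomb a A"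
      by (rule V.lincomb_cong) (use that AV in auto)
    have "V.lincomb a A \<in> carrier V" using that AV by blast
    then have "coord (V.lincomb a A) = restrict a A"
      using uniqV[of "V.lincomb a A"] coord[of "V.lincomb a A"] eq that
      by (metis restrict_PiE_iff Pi_iff)
    then show ?thesis using that by simp
  qed
  define f where "f v = W.lincomb (coord v \<circ> r) B" for v
  have coord_r: "coord v \<circ> r \<in> B \<rightarrow> carrier K" if "v \<in> carrier V" for v
    using coord(1)[OF that] rB by auto
  have closed: "f v \<in> carrier W" if "v \<in> carrier V" for v
    using coord_r[OF that] BW unfolding f_def by blast
  have f_lincomb: "f (V.lincomb a A) = W.lincomb (a \<circ> r) B" if "a \<in> A \<rightarrow> carrier K" for a
    unfolding f_def
    by (rule W.lincomb_cong) (use BW that rB coord_unique in auto)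
  have "f \<in> module_hom K V W"
    unfolding module_hom_def
  proof (intro CollectI conjI allI impI, goal_cases)
    case 1 show ?case using closed by blast
  next
    case (2 u v)
    have *: "(\<lambda>a. coord u a \<oplus>\<^bsub>K\<^esub> coord v a) \<in> A \<rightarrow> carrier K"
      using coord_Pi[of u] coord_Pi[of v] 2 by (auto simp: Pi_iff)
    have "u \<oplus>\<^bsub>V\<^esub> v = V.lincomb (\<lambda>a. coord u a \<oplus>\<^bsub>K\<^esub> coord v a) A"
      using V.lincomb_sum[OF A(1) AV coord_Pi coord_Pi, of u v] coord(2)[of u] coord(2)[of v] 2 by (simp only:)
    then have "f (u \<oplus>\<^bsub>V\<^esub> v) = W.lincomb (\<lambda>b. (coord u \<circ> r) b \<oplus>\<^bsub>K\<^esub> (coord v \<circ> r) b) B"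
      using f_lincomb[OF *] by (simp only: comp_def)
    then show ?case
      using W.lincomb_sum[OF B(1) BW coord_r coord_r, of u v] 2 by (simp add: f_def)
  next
    case (3 c v)
    have *: "(\<lambda>a. c \<otimes>\<^bsub>K\<^esub> coord v a) \<in> A \<rightarrow> carrier K"
      using coord_Pi[of v] 3 by (auto simp: Pi_iff)
    have "c \<odot>\<^bsub>V\<^esub> v = V.lincomb (\<lambda>a. c \<otimes>\<^bsub>K\<^esub> coord v a) A"
      using V.lincomb_smult[OF AV coord_Pi, of v c] coord(2)[of v] 3 by (simp only:)
    then have "f (c \<odot>\<^bsub>V\<^esub> v) = W.lincomb (\<lambda>b. c \<otimes>\<^bsub>K\<^esub> (coord v \<circ> r) b) B"
      using f_lincomb[OF *] by (simp only: comp_def)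
    then show ?case
      using W.lincomb_smult[OF BW coord_r, of v c] 3 by (simp add: f_def)
  qed
  moreover have "bij_betw f (carrier V) (carrier W)"
    unfolding bij_betw_def
  proof (intro conjI inj_onI subset_antisym subsetI)
    fix u v assume uv: "u \<in> carrier V" "v \<in> carrier V" and eq: "f u = f v"
    have "W.lincomb (restrict (coord u \<circ> r) B) B = f u" "W.lincomb (restrict (coord v \<circ> r) B) B = f v"
      using coord_r uv BW unfolding f_def by (auto intro!: W.lincomb_cong)
    moreover have "restrict (coord u \<circ> r) B \<in> B \<rightarrow>\<^sub>E carrier K" "restrict (coord v \<circ> r) B \<in> B \<rightarrow>\<^sub>E carrier K"
      using coord_r uv by (auto simp: Pi_iff)
    ultimately have "restrict (coord u \<circ> r) B = restrict (coord v \<circ> r) B"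
      using uniqW[OF closed[OF uv(1)]] eq by metis
    then have *: "coord u (r b) = coord v (r b)" if "b \<in> B" for b
      using that by (metis comp_apply restrict_apply')
    have "coord u a = coord v a" if "a \<in> A" for a
      using *[OF sA[OF that]] rs[OF that] by simp
    then have "coord u = coord v"
      using coord(1) uv by (meson PiE_ext)
    then show "u = v" using coord(2) uv by metis
  next
    fix w assume w: "w \<in> carrier W"
    then obtain b where b: "b \<in> B \<rightarrow>\<^sub>E carrier K" "W.lincomb b B = w" using uniqW by blast
    have bs: "b \<circ> s \<in> A \<rightarrow> carrier K" using b sA by auto
    have "f (V.lincomb (b \<circ> s) A) = W.lincomb (b \<circ> s \<circ> r) B"
      using bs by (rule f_lincomb)
    also have "\<dots> = w"
      using W.lincomb_cong[OF refl BW, of "b \<circ> s \<circ> r" b] b sr by (simp add: PiE_iff Pi_iff)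
    finally show "w \<in> f ` carrier V"
      using V.lincomb_closed[OF AV bs] by blast
  qed (use closed in auto)
  ultimately show ?thesis by (rule that)
qed

text \<open>
  The zero space on one point of the given type serves as \<open>V\<close> when the scwol has no object, so that the
  sheaf supplies no space.
\<close>

lemma finite_dimensional_space_exists:
  assumes "field K"
  shows "\<exists>V :: ('k, 'v) module. vectorspace (K :: ('k, 'r) ring_scheme) V \<and> vectorspace.fin_dim K V"
proof -
  interpret K: field K by fact
  define V :: "('k, 'v) module" where "V = \<lparr>carrier = {undefined}, mult = \<lambda>_ _. undefined,
    one = undefined, zero = undefined, add = \<lambda>_ _. undefined, smult = \<lambda>_ _. undefined\<rparr>"
  have carrier: "carrier V = {undefined}" and zero: "\<zero>\<^bsub>V\<^esub> = undefined"
    and ops: "\<And>u v. u \<oplus>\<^bsub>V\<^esub> v = undefined" "\<And>c v. c \<odot>\<^bsub>V\<^esub> v = undefined"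
    by (simp_all add: V_def)
  have "abelian_group V"
    by (rule abelian_groupI) (simp_all only: carrier zero ops singleton_iff simp_thms bex_simps insert_iff, simp_all)
  then have "module K V"
    by (intro moduleI) (simp_all only: carrier zero ops singleton_iff simp_thms K.is_cring)
  then interpret vectorspace K V
    by (rule vectorspace.intro) (rule assms)
  have "gen_set {}"
    unfolding span_empty carrier zero ..
  then have "fin_dim" unfolding fin_dim_def by blast
  then show ?thesis using vectorspace_axioms by blast
qed

section \<open>Morphisms to a group as functors\<close>

lemma (in scwol) Arr_cmp:
  assumes "a \<in> Arr C" and "b \<in> Arr C" and "ini C a = ter C b"
  shows "a \<cdot> b \<in> Arr C"
proof -
  have "a \<in> Mor C" "b \<in> Mor C" using assms by (simp_all add: Arr_def)
  then have "a \<cdot> b \<in> Mor C" using assms by (simp add: cmp_closed)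
  moreover have "a \<cdot> b \<notin> Idn C ` Obj C"
    using no_cycles[OF assms] by (auto simp: ini_Idn ter_Idn)
  ultimately show ?thesis by (simp add: Arr_def)
qed

text \<open>
  Identities are idempotent, so a multiplicative map into a group sends them to the unit.
\<close>

definition functor_to_group :: "('o, 'm) precategory \<Rightarrow> ('h, 'x) monoid_scheme \<Rightarrow> ('m \<Rightarrow> 'h) \<Rightarrow> bool"
  where "functor_to_group D G \<Phi> \<longleftrightarrow> \<Phi> \<in> Mor D \<rightarrow> carrier G \<and>
    (\<forall>l\<in>Mor D. \<forall>m\<in>Mor D. ini D l = ter D m \<longrightarrow> \<Phi> (l \<cdot>\<^bsub>D\<^esub> m) = \<Phi> l \<otimes>\<^bsub>G\<^esub> \<Phi> m)"

definition endos :: "('o, 'm) precategory \<Rightarrow> 'o \<Rightarrow> 'm set"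
  where "endos D x = {l \<in> Mor D. ini D l = x \<and> ter D l = x}"

lemma BH_simps:
  "Obj (BH_category \<Lambda>) = Obj (base \<Lambda>)"
  "(g, \<alpha>) \<in> Mor (BH_category \<Lambda>) \<longleftrightarrow> \<alpha> \<in> Mor (base \<Lambda>) \<and> g \<in> carrier (lgrp \<Lambda> (ter (base \<Lambda>) \<alpha>))"
  "ini (BH_category \<Lambda>) (g, \<alpha>) = ini (base \<Lambda>) \<alpha>"
  "ter (BH_category \<Lambda>) (g, \<alpha>) = ter (base \<Lambda>) \<alpha>"
  "Idn (BH_category \<Lambda>) \<sigma> = (\<one>\<^bsub>lgrp \<Lambda> \<sigma>\<^esub>, Idn (base \<Lambda>) \<sigma>)"
  "(g, \<alpha>) \<cdot>\<^bsub>BH_category \<Lambda>\<^esub> (h, \<beta>) =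
    (g \<otimes>\<^bsub>lgrp \<Lambda> (ter (base \<Lambda>) \<alpha>)\<^esub> psi_ext \<Lambda> \<alpha> h \<otimes>\<^bsub>lgrp \<Lambda> (ter (base \<Lambda>) \<alpha>)\<^esub> twist_ext \<Lambda> \<alpha> \<beta>,
     \<alpha> \<cdot>\<^bsub>base \<Lambda>\<^esub> \<beta>)"
  by (simp_all add: BH_category_def)

lemma (in category) Mor_cases:
  assumes "a \<in> Mor C"
  obtains (Idn) x where "x \<in> Obj C" "a = Idn C x" | (Arr) "a \<in> Arr C"
  using assms by (auto simp: Arr_def)

lemma (in category) Arr_imp_Mor: "a \<in> Arr C \<Longrightarrow> a \<in> Mor C"
  by (simp add: Arr_def)

lemma (in category) Idn_notin_Arr: "x \<in> Obj C \<Longrightarrow> Idn C x \<notin> Arr C"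
  by (simp add: Arr_def)

context complex_of_groups
begin

sublocale base: scwol C
  by (rule scwol_base)

lemma psi_ext_closed:
  assumes "\<alpha> \<in> Mor C" and "g \<in> carrier (lgrp \<Lambda> (ini C \<alpha>))"
  shows "psi_ext \<Lambda> \<alpha> g \<in> carrier (lgrp \<Lambda> (ter C \<alpha>))"
  using assms(1)
proof (cases rule: base.Mor_cases)
  case (Idn x)
  then show ?thesis
    using assms(2) by (simp add: psi_ext_def base.Idn_notin_Arr base.ini_Idn base.ter_Idn flip: C_def)
next
  case Arr
  then show ?thesis
    using psi_mon[OF Arr] assms(2) by (auto simp: psi_ext_def mon_def hom_def simp flip: C_def)
qed

lemma twist_ext_closed:
  assumes "\<alpha> \<in> Mor C" and "\<beta> \<in> Mor C" and "ini C \<alpha> = ter C \<beta>"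
  shows "twist_ext \<Lambda> \<alpha> \<beta> \<in> carrier (lgrp \<Lambda> (ter C \<alpha>))"
proof -
  interpret t: group "lgrp \<Lambda> (ter C \<alpha>)" using assms by (simp add: lgrp_group base.ter_closed)
  show ?thesis
    using assms by (simp add: twist_ext_def twist_closed flip: C_def)
qed

lemma psi_one: "a \<in> Arr C \<Longrightarrow> psi \<Lambda> a \<one>\<^bsub>lgrp \<Lambda> (ini C a)\<^esub> = \<one>\<^bsub>lgrp \<Lambda> (ter C a)\<^esub>"
  using hom_one[of "psi \<Lambda> a" "lgrp \<Lambda> (ini C a)" "lgrp \<Lambda> (ter C a)"] psi_mon[of a]
  by (simp add: mon_def lgrp_group base.ini_closed base.ter_closed base.Arr_imp_Mor)

lemma BH_ends:
  assumes "l \<in> Mor (BH_category \<Lambda>)"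
  shows "ini (BH_category \<Lambda>) l \<in> Obj (BH_category \<Lambda>)" "ter (BH_category \<Lambda>) l \<in> Obj (BH_category \<Lambda>)"
  using assms by (cases l; simp add: BH_simps base.ini_closed base.ter_closed flip: C_def)+

lemma BH_cmp_ends:
  assumes "l \<in> Mor (BH_category \<Lambda>)" and "m \<in> Mor (BH_category \<Lambda>)"
    and "ini (BH_category \<Lambda>) l = ter (BH_category \<Lambda>) m"
  shows "ini (BH_category \<Lambda>) (l \<cdot>\<^bsub>BH_category \<Lambda>\<^esub> m) = ini (BH_category \<Lambda>) m"
    "ter (BH_category \<Lambda>) (l \<cdot>\<^bsub>BH_category \<Lambda>\<^esub> m) = ter (BH_category \<Lambda>) l"
  using assms by (cases l; cases m; simp add: BH_simps base.ini_cmp base.ter_cmp flip: C_def)+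

text \<open>
  A loop of the scwol is an identity, so nothing but the local group remains over it.
\<close>

lemma endos_BH_category:
  assumes "\<sigma> \<in> Obj C"
  shows "endos (BH_category \<Lambda>) \<sigma> = (\<lambda>g. (g, Idn C \<sigma>)) ` carrier (lgrp \<Lambda> \<sigma>)"
proof (intro equalityI subsetI)
  fix l assume "l \<in> endos (BH_category \<Lambda>) \<sigma>"
  then obtain g \<alpha> where l: "l = (g, \<alpha>)" and \<alpha>: "\<alpha> \<in> Mor C" "ini C \<alpha> = \<sigma>" "ter C \<alpha> = \<sigma>"
    and g: "g \<in> carrier (lgrp \<Lambda> \<sigma>)"
    by (cases l) (auto simp: endos_def BH_simps simp flip: C_def)
  have "\<alpha> = Idn C \<sigma>" using base.no_loops[OF \<alpha>(1)] \<alpha>(2,3) by simp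
  then show "l \<in> (\<lambda>g. (g, Idn C \<sigma>)) ` carrier (lgrp \<Lambda> \<sigma>)" using l g by blast
next
  fix l assume "l \<in> (\<lambda>g. (g, Idn C \<sigma>)) ` carrier (lgrp \<Lambda> \<sigma>)"
  then show "l \<in> endos (BH_category \<Lambda>) \<sigma>"
    using assms by (auto simp: endos_def BH_simps base.Idn_closed base.ini_Idn base.ter_Idn simp flip: C_def)
qed

lemma inj_on_endos_BH_category:
  assumes "\<sigma> \<in> Obj C"
  shows "inj_on \<Phi> (endos (BH_category \<Lambda>) \<sigma>) \<longleftrightarrow> inj_on (\<lambda>g. \<Phi> (g, Idn C \<sigma>)) (carrier (lgrp \<Lambda> \<sigma>))"
  unfolding endos_BH_category[OF assms] by (auto simp: inj_on_def)

end

text \<open>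
  The value at identities is forced: it is the one for which the relations of a morphism to a group
  extend to all morphisms, given the conventions in \<open>psi_ext\<close> and \<open>twist_ext\<close>.
\<close>

definition arrow_ext :: "('o, 'm, 'g) complex_of_groups_data \<Rightarrow> ('h, 'x) monoid_scheme \<Rightarrow> ('m \<Rightarrow> 'h) \<Rightarrow> 'm \<Rightarrow> 'h"
  where "arrow_ext \<Lambda> G \<phi>a \<alpha> = (if \<alpha> \<in> Arr (base \<Lambda>) then \<phi>a \<alpha> else \<one>\<^bsub>G\<^esub>)"

locale complex_morphism_to_group = complex_of_groups \<Lambda> C + \<phi>: morphism_to_group \<Lambda> G \<phi> \<phi>a C
  for \<Lambda> :: "('o, 'm, 'g) complex_of_groups_data" and C :: "('o, 'm) precategory"
    and G :: "'h monoid" (structure) and \<phi> :: "'o \<Rightarrow> 'g \<Rightarrow> 'h" and \<phi>a :: "'m \<Rightarrow> 'h"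
begin

abbreviation e :: "'m \<Rightarrow> 'h"
  where "e \<equiv> arrow_ext \<Lambda> G \<phi>a"

lemma e_Arr: "a \<in> Arr C \<Longrightarrow> e a = \<phi>a a"
  by (simp add: arrow_ext_def flip: C_def)

lemma e_Idn: "\<sigma> \<in> Obj C \<Longrightarrow> e (Idn C \<sigma>) = \<one>"
  by (simp add: arrow_ext_def base.Idn_notin_Arr flip: C_def)

lemma e_closed: "\<alpha> \<in> Mor C \<Longrightarrow> e \<alpha> \<in> carrier G"
  by (simp add: arrow_ext_def \<phi>.arr_closed flip: C_def)

lemma local_closed: "\<lbrakk>\<sigma> \<in> Obj C; g \<in> carrier (lgrp \<Lambda> \<sigma>)\<rbrakk> \<Longrightarrow> \<phi> \<sigma> g \<in> carrier G"
  using \<phi>.hom[of \<sigma>] by (auto simp: hom_def)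

lemma local_mult: "\<lbrakk>\<sigma> \<in> Obj C; g \<in> carrier (lgrp \<Lambda> \<sigma>); h \<in> carrier (lgrp \<Lambda> \<sigma>)\<rbrakk>
    \<Longrightarrow> \<phi> \<sigma> (g \<otimes>\<^bsub>lgrp \<Lambda> \<sigma>\<^esub> h) = \<phi> \<sigma> g \<otimes> \<phi> \<sigma> h"
  using \<phi>.hom[of \<sigma>] by (auto simp: hom_def)

lemma local_one: "\<sigma> \<in> Obj C \<Longrightarrow> \<phi> \<sigma> \<one>\<^bsub>lgrp \<Lambda> \<sigma>\<^esub> = \<one>"
  using hom_one[OF \<phi>.hom lgrp_group] by simp

text \<open>
  Moving \<open>e \<alpha>\<close> past an element of a local group is one of the two relations that make the functor below
  multiplicative; the other one is \<open>e_cmp\<close>.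
\<close>

lemma e_conj:
  assumes "\<alpha> \<in> Mor C" and g: "g \<in> carrier (lgrp \<Lambda> (ini C \<alpha>))"
  shows "\<phi> (ter C \<alpha>) (psi_ext \<Lambda> \<alpha> g) \<otimes> e \<alpha> = e \<alpha> \<otimes> \<phi> (ini C \<alpha>) g"
  using assms(1)
proof (cases rule: base.Mor_cases)
  case (Idn \<sigma>)
  then show ?thesis
    using g local_closed
    by (simp add: psi_ext_def base.Idn_notin_Arr base.ini_Idn base.ter_Idn e_Idn flip: C_def)
next
  case Arr
  have c: "\<phi>a \<alpha> \<in> carrier G" "\<phi> (ini C \<alpha>) g \<in> carrier G"
    using Arr assms by (simp_all add: \<phi>.arr_closed local_closed base.ini_closed)
  have "\<phi> (ter C \<alpha>) (psi \<Lambda> \<alpha> g) \<otimes> \<phi>a \<alpha> = \<phi>a \<alpha> \<otimes> \<phi> (ini C \<alpha>) g"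
    using c by (simp add: \<phi>.arr_conj[OF Arr g] Ad_def \<phi>.m_assoc)
  then show ?thesis
    using Arr by (simp add: psi_ext_def e_Arr flip: C_def)
qed

lemma e_cmp:
  assumes "\<alpha> \<in> Mor C" and "\<beta> \<in> Mor C" and \<alpha>\<beta>: "ini C \<alpha> = ter C \<beta>"
  shows "\<phi> (ter C \<alpha>) (twist_ext \<Lambda> \<alpha> \<beta>) \<otimes> e (\<alpha> \<cdot>\<^bsub>C\<^esub> \<beta>) = e \<alpha> \<otimes> e \<beta>"
proof -
  note closed = e_closed[OF assms(1)] e_closed[OF assms(2)] base.ter_closed[OF assms(1)]
  consider "\<alpha> \<in> Arr C" "\<beta> \<in> Arr C" | \<sigma> where "\<sigma> \<in> Obj C" "\<alpha> = Idn C \<sigma>"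
    | \<sigma> where "\<sigma> \<in> Obj C" "\<beta> = Idn C \<sigma>"
    using assms by (auto simp: Arr_def)
  then show ?thesis
  proof cases
    case 1
    then show ?thesis
      using \<phi>.arr_cmp[OF 1 \<alpha>\<beta>] base.Arr_cmp[OF 1 \<alpha>\<beta>] by (simp add: twist_ext_def e_Arr flip: C_def)
  next
    case 2
    then have "\<alpha> \<cdot>\<^bsub>C\<^esub> \<beta> = \<beta>" using assms base.Idn_left[of \<beta>] by (simp add: base.ini_Idn)
    then show ?thesis
      using 2 closed local_one by (simp add: twist_ext_def base.Idn_notin_Arr e_Idn flip: C_def)
  next
    case 3
    then have "\<alpha> \<cdot>\<^bsub>C\<^esub> \<beta> = \<alpha>" using assms base.Idn_right[of \<alpha>] by (simp add: base.ter_Idn)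
    then show ?thesis
      using 3 closed local_one by (simp add: twist_ext_def base.Idn_notin_Arr e_Idn flip: C_def)
  qed
qed

lemma functor_BH_category:
  "functor_to_group (BH_category \<Lambda>) G (\<lambda>(g, \<alpha>). \<phi> (ter C \<alpha>) g \<otimes> e \<alpha>)"
  unfolding functor_to_group_def
proof (intro conjI ballI impI funcsetI)
  fix l assume "l \<in> Mor (BH_category \<Lambda>)"
  then show "(\<lambda>(g, \<alpha>). \<phi> (ter C \<alpha>) g \<otimes> e \<alpha>) l \<in> carrier G"
    by (cases l) (simp add: BH_simps local_closed e_closed base.ter_closed flip: C_def)
next
  fix l m assume l: "l \<in> Mor (BH_category \<Lambda>)" and m: "m \<in> Mor (BH_category \<Lambda>)"
    and lm: "ini (BH_category \<Lambda>) l = ter (BH_category \<Lambda>) m"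
  obtain g \<alpha> where l_eq: "l = (g, \<alpha>)" and \<alpha>: "\<alpha> \<in> Mor C" and g: "g \<in> carrier (lgrp \<Lambda> (ter C \<alpha>))"
    using l by (cases l) (simp add: BH_simps flip: C_def)
  obtain h \<beta> where m_eq: "m = (h, \<beta>)" and \<beta>: "\<beta> \<in> Mor C" and h: "h \<in> carrier (lgrp \<Lambda> (ter C \<beta>))"
    using m by (cases m) (simp add: BH_simps flip: C_def)
  have \<alpha>\<beta>: "ini C \<alpha> = ter C \<beta>"
    using lm by (simp add: l_eq m_eq BH_simps flip: C_def)
  interpret t: group "lgrp \<Lambda> (ter C \<alpha>)" using \<alpha> by (simp add: lgrp_group base.ter_closed)
  let ?p = "psi_ext \<Lambda> \<alpha> h" and ?t = "twist_ext \<Lambda> \<alpha> \<beta>" and ?\<phi> = "\<phi> (ter C \<alpha>)"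
  have p: "?p \<in> carrier (lgrp \<Lambda> (ter C \<alpha>))" using psi_ext_closed[OF \<alpha>] h \<alpha>\<beta> by simp
  have t: "?t \<in> carrier (lgrp \<Lambda> (ter C \<alpha>))" using twist_ext_closed[OF \<alpha> \<beta> \<alpha>\<beta>] .
  note T = base.ter_closed[OF \<alpha>]
  note closed = local_closed[OF T g] local_closed[OF T p] local_closed[OF T t] e_closed[OF \<alpha>] e_closed[OF \<beta>]
    e_closed[OF base.cmp_closed[OF \<alpha> \<beta> \<alpha>\<beta>]] local_closed[OF base.ter_closed[OF \<beta>] h]
  have "?\<phi> (g \<otimes>\<^bsub>lgrp \<Lambda> (ter C \<alpha>)\<^esub> ?p \<otimes>\<^bsub>lgrp \<Lambda> (ter C \<alpha>)\<^esub> ?t) \<otimes> e (\<alpha> \<cdot>\<^bsub>C\<^esub> \<beta>)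
      = ?\<phi> g \<otimes> ?\<phi> ?p \<otimes> (?\<phi> ?t \<otimes> e (\<alpha> \<cdot>\<^bsub>C\<^esub> \<beta>))"
    using g p t T closed by (simp add: local_mult \<phi>.m_assoc)
  also have "\<dots> = ?\<phi> g \<otimes> (?\<phi> ?p \<otimes> e \<alpha>) \<otimes> e \<beta>"
    using closed by (simp add: e_cmp[OF \<alpha> \<beta> \<alpha>\<beta>] \<phi>.m_assoc)
  also have "\<dots> = ?\<phi> g \<otimes> e \<alpha> \<otimes> (\<phi> (ter C \<beta>) h \<otimes> e \<beta>)"
    using closed h by (simp add: e_conj[OF \<alpha>] \<alpha>\<beta> \<phi>.m_assoc)
  finally show "(\<lambda>(g, \<alpha>). \<phi> (ter C \<alpha>) g \<otimes> e \<alpha>) (l \<cdot>\<^bsub>BH_category \<Lambda>\<^esub> m)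
      = (\<lambda>(g, \<alpha>). \<phi> (ter C \<alpha>) g \<otimes> e \<alpha>) l \<otimes> (\<lambda>(g, \<alpha>). \<phi> (ter C \<alpha>) g \<otimes> e \<alpha>) m"
    using base.ter_cmp[OF \<alpha> \<beta> \<alpha>\<beta>] by (simp add: l_eq m_eq BH_simps flip: C_def)
qed

end

text \<open>
  Each axiom of a morphism comes from two factorizations of one morphism of the B.H. category. The
  conjugation axiom is \<open>(\<psi>\<^sub>a g, 1) (1, a) = (1, a) (g, 1)\<close>, and the composition axiom is
  \<open>(g\<^sub>a\<^sub>,\<^sub>b, 1) (1, ab) = (1, a) (1, b)\<close>.
\<close>

lemma (in complex_of_groups) functor_imp_morphism:
  fixes G :: "'h monoid" (structure)
  assumes "group G" and \<Phi>: "functor_to_group (BH_category \<Lambda>) G \<Phi>"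
  shows "morphism_to_group \<Lambda> G (\<lambda>\<sigma> g. \<Phi> (g, Idn C \<sigma>)) (\<lambda>a. \<Phi> (\<one>\<^bsub>lgrp \<Lambda> (ter C a)\<^esub>, a))"
proof -
  interpret G: group G by fact
  have closed: "\<Phi> (g, \<alpha>) \<in> carrier G" if "\<alpha> \<in> Mor C" "g \<in> carrier (lgrp \<Lambda> (ter C \<alpha>))" for g \<alpha>
    using \<Phi> that by (auto simp: functor_to_group_def BH_simps Pi_iff simp flip: C_def)
  have mult: "\<Phi> (g \<otimes>\<^bsub>lgrp \<Lambda> (ter C \<alpha>)\<^esub> psi_ext \<Lambda> \<alpha> h \<otimes>\<^bsub>lgrp \<Lambda> (ter C \<alpha>)\<^esub> twist_ext \<Lambda> \<alpha> \<beta>, \<alpha> \<cdot>\<^bsub>C\<^esub> \<beta>)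
      = \<Phi> (g, \<alpha>) \<otimes>\<^bsub>G\<^esub> \<Phi> (h, \<beta>)"
    if "\<alpha> \<in> Mor C" "g \<in> carrier (lgrp \<Lambda> (ter C \<alpha>))" "\<beta> \<in> Mor C" "h \<in> carrier (lgrp \<Lambda> (ter C \<beta>))"
      "ini C \<alpha> = ter C \<beta>" for g h \<alpha> \<beta>
  proof -
    have "\<Phi> ((g, \<alpha>) \<cdot>\<^bsub>BH_category \<Lambda>\<^esub> (h, \<beta>)) = \<Phi> (g, \<alpha>) \<otimes>\<^bsub>G\<^esub> \<Phi> (h, \<beta>)"
      using \<Phi> that by (simp add: functor_to_group_def BH_simps(2-4) flip: C_def)
    then show ?thesis by (simp add: BH_simps flip: C_def)
  qed
  have mult_left: "\<Phi> (g \<otimes>\<^bsub>lgrp \<Lambda> (ter C \<beta>)\<^esub> h, \<beta>) = \<Phi> (g, Idn C (ter C \<beta>)) \<otimes>\<^bsub>G\<^esub> \<Phi> (h, \<beta>)"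
    if \<beta>: "\<beta> \<in> Mor C" and g: "g \<in> carrier (lgrp \<Lambda> (ter C \<beta>))" and h: "h \<in> carrier (lgrp \<Lambda> (ter C \<beta>))" for g h \<beta>
  proof -
    have T: "ter C \<beta> \<in> Obj C" using \<beta> by (rule base.ter_closed)
    interpret t: group "lgrp \<Lambda> (ter C \<beta>)" using T by (rule lgrp_group)
    show ?thesis
      using mult[of "Idn C (ter C \<beta>)" g \<beta> h] T \<beta> g h
      by (simp add: base.Idn_closed base.ini_Idn base.ter_Idn base.Idn_left psi_ext_def twist_ext_def
          base.Idn_notin_Arr flip: C_def)
  qed
  show ?thesis
  proof (rule morphism_to_group.intro[OF assms(1)], unfold_locales, fold C_def)
    fix \<sigma> assume \<sigma>: "\<sigma> \<in> Obj C"
    show "(\<lambda>g. \<Phi> (g, Idn C \<sigma>)) \<in> hom (lgrp \<Lambda> \<sigma>) G"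
      using mult_left[of "Idn C \<sigma>"] closed[of "Idn C \<sigma>"] \<sigma>
      by (auto simp: hom_def base.Idn_closed base.ter_Idn)
  next
    fix a assume "a \<in> Arr C"
    then have a: "a \<in> Mor C" by (rule base.Arr_imp_Mor)
    interpret t: group "lgrp \<Lambda> (ter C a)" using a by (simp add: lgrp_group base.ter_closed)
    show "\<Phi> (\<one>\<^bsub>lgrp \<Lambda> (ter C a)\<^esub>, a) \<in> carrier G" using a by (simp add: closed)
  next
    fix a g assume a': "a \<in> Arr C" and g: "g \<in> carrier (lgrp \<Lambda> (ini C a))"
    then have a: "a \<in> Mor C" and I: "ini C a \<in> Obj C" and T: "ter C a \<in> Obj C"
      by (simp_all add: base.Arr_imp_Mor base.ini_closed base.ter_closed)
    interpret t: group "lgrp \<Lambda> (ter C a)" using T by (rule lgrp_group)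
    have psi: "psi \<Lambda> a g \<in> carrier (lgrp \<Lambda> (ter C a))"
      using psi_ext_closed[OF a g] a' by (simp add: psi_ext_def flip: C_def)
    have "\<Phi> (psi \<Lambda> a g, Idn C (ter C a)) \<otimes>\<^bsub>G\<^esub> \<Phi> (\<one>\<^bsub>lgrp \<Lambda> (ter C a)\<^esub>, a) = \<Phi> (psi \<Lambda> a g, a)"
      using mult_left[OF a psi t.one_closed] psi by simp
    also have "\<dots> = \<Phi> (\<one>\<^bsub>lgrp \<Lambda> (ter C a)\<^esub>, a) \<otimes>\<^bsub>G\<^esub> \<Phi> (g, Idn C (ini C a))"
      using mult[OF a t.one_closed base.Idn_closed[OF I], of g] g I T psi a a'
      by (simp add: base.ter_Idn base.Idn_right psi_ext_def twist_ext_def base.Idn_notin_Arr flip: C_def)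
    finally have *: "\<Phi> (psi \<Lambda> a g, Idn C (ter C a)) \<otimes>\<^bsub>G\<^esub> \<Phi> (\<one>\<^bsub>lgrp \<Lambda> (ter C a)\<^esub>, a)
      = \<Phi> (\<one>\<^bsub>lgrp \<Lambda> (ter C a)\<^esub>, a) \<otimes>\<^bsub>G\<^esub> \<Phi> (g, Idn C (ini C a))" .
    have "\<Phi> (psi \<Lambda> a g, Idn C (ter C a)) \<in> carrier G" "\<Phi> (\<one>\<^bsub>lgrp \<Lambda> (ter C a)\<^esub>, a) \<in> carrier G"
      "\<Phi> (g, Idn C (ini C a)) \<in> carrier G"
      using closed a psi g I T by (simp_all add: base.Idn_closed base.ter_Idn)
    then show "\<Phi> (psi \<Lambda> a g, Idn C (ter C a)) = Ad G (\<Phi> (\<one>\<^bsub>lgrp \<Lambda> (ter C a)\<^esub>, a)) (\<Phi> (g, Idn C (ini C a)))"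
      unfolding Ad_def * [symmetric] by (simp add: G.m_assoc)
  next
    fix a b assume a': "a \<in> Arr C" and b': "b \<in> Arr C" and ab: "ini C a = ter C b"
    then have a: "a \<in> Mor C" and b: "b \<in> Mor C" and ab_Mor: "a \<cdot>\<^bsub>C\<^esub> b \<in> Mor C" and ab_ter: "ter C (a \<cdot>\<^bsub>C\<^esub> b) = ter C a"
      by (simp_all add: base.Arr_imp_Mor base.cmp_closed base.ter_cmp)
    interpret t: group "lgrp \<Lambda> (ter C a)" using a by (simp add: lgrp_group base.ter_closed)
    interpret i: group "lgrp \<Lambda> (ter C b)" using b by (simp add: lgrp_group base.ter_closed)
    have twist: "twist \<Lambda> a b \<in> carrier (lgrp \<Lambda> (ter C a))" using a' b' ab by (rule twist_closed)
    have "\<Phi> (twist \<Lambda> a b, Idn C (ter C a)) \<otimes>\<^bsub>G\<^esub> \<Phi> (\<one>\<^bsub>lgrp \<Lambda> (ter C a)\<^esub>, a \<cdot>\<^bsub>C\<^esub> b) = \<Phi> (twist \<Lambda> a b, a \<cdot>\<^bsub>C\<^esub> b)"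
      using mult_left[OF ab_Mor, of "twist \<Lambda> a b" "\<one>\<^bsub>lgrp \<Lambda> (ter C a)\<^esub>"] twist by (simp add: ab_ter)
    also have "\<dots> = \<Phi> (\<one>\<^bsub>lgrp \<Lambda> (ter C a)\<^esub>, a) \<otimes>\<^bsub>G\<^esub> \<Phi> (\<one>\<^bsub>lgrp \<Lambda> (ter C b)\<^esub>, b)"
      using mult[OF a t.one_closed b i.one_closed ab] a' b' ab twist psi_one[OF a']
      by (simp add: psi_ext_def twist_ext_def flip: C_def)
    finally show "\<Phi> (twist \<Lambda> a b, Idn C (ter C a)) \<otimes>\<^bsub>G\<^esub> \<Phi> (\<one>\<^bsub>lgrp \<Lambda> (ter C (a \<cdot>\<^bsub>C\<^esub> b))\<^esub>, a \<cdot>\<^bsub>C\<^esub> b)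
      = \<Phi> (\<one>\<^bsub>lgrp \<Lambda> (ter C a)\<^esub>, a) \<otimes>\<^bsub>G\<^esub> \<Phi> (\<one>\<^bsub>lgrp \<Lambda> (ter C b)\<^esub>, b)"
      by (simp add: ab_ter)
  qed
qed

section \<open>Translation actions on families of cosets\<close>

context group
begin

text \<open>
  The tag \<open>i\<close> keeps the cosets of \<open>M i\<close> and \<open>M j\<close> apart even if these subgroups coincide.
\<close>

definition coset_fibre :: "('i \<Rightarrow> 'a set) \<Rightarrow> 'i \<Rightarrow> ('a set \<times> 'i) set"
  where "coset_fibre M i = (\<lambda>g. (g <#\<^bsub>G\<^esub> M i, i)) ` carrier G"

definition coset_space :: "('i \<Rightarrow> 'a set) \<Rightarrow> 'i set \<Rightarrow> ('a set \<times> 'i) set"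
  where "coset_space M I = (\<Union>i\<in>I. coset_fibre M i)"

definition translation :: "('a set \<times> 'i) set \<Rightarrow> 'a \<Rightarrow> 'a set \<times> 'i \<Rightarrow> 'a set \<times> 'i"
  where "translation E h = (\<lambda>(S, i)\<in>E. (h <#\<^bsub>G\<^esub> S, i))"

lemma inv_mult_cancel:
  assumes "a \<in> carrier G" and "b \<in> carrier G"
  shows "inv a \<otimes> (a \<otimes> b) = b" and "a \<otimes> (inv a \<otimes> b) = b"
  using assms by (simp_all flip: m_assoc)

lemma l_coset_eq_iff:
  assumes "subgroup H G" and "g \<in> carrier G" and "h \<in> carrier G"
  shows "g <#\<^bsub>G\<^esub> H = h <#\<^bsub>G\<^esub> H \<longleftrightarrow> inv g \<otimes> h \<in> H"
proof
  interpret H: subgroup H G by fact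
  assume "g <#\<^bsub>G\<^esub> H = h <#\<^bsub>G\<^esub> H"
  moreover have "h \<otimes> \<one> \<in> h <#\<^bsub>G\<^esub> H"
    unfolding l_coset_def using H.one_closed by blast
  ultimately have "h \<in> g <#\<^bsub>G\<^esub> H"
    using assms(3) by simp
  then obtain x where x: "x \<in> H" "h = g \<otimes> x"
    by (auto simp: l_coset_def)
  have "inv g \<otimes> h = x"
    unfolding x(2) using assms(2) H.mem_carrier[OF x(1)] by (rule inv_mult_cancel)
  then show "inv g \<otimes> h \<in> H"
    using x(1) by simp
next
  interpret H: subgroup H G by fact
  assume x: "inv g \<otimes> h \<in> H"
  have "g <#\<^bsub>G\<^esub> H = g <#\<^bsub>G\<^esub> ((inv g \<otimes> h) <#\<^bsub>G\<^esub> H)"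
    using coset_join3[OF _ assms(1) x] assms by simp
  also have "\<dots> = (g \<otimes> (inv g \<otimes> h)) <#\<^bsub>G\<^esub> H"
    using assms H.subset by (simp add: lcos_m_assoc)
  also have "g \<otimes> (inv g \<otimes> h) = h"
    using assms by (simp add: inv_mult_cancel)
  finally show "g <#\<^bsub>G\<^esub> H = h <#\<^bsub>G\<^esub> H" .
qed

text \<open>
  Objects and morphisms of the quotient are whole orbits; this recovers the index below an orbit.
\<close>

definition fibre_index :: "('a set \<times> 'i) set \<Rightarrow> 'i"
  where "fibre_index S = the_elem (snd ` S)"

lemma fibre_index_coset_fibre: "fibre_index (coset_fibre M i) = i"
proof -
  have "snd ` coset_fibre M i = {i}"
    using one_closed by (auto simp: coset_fibre_def image_image image_constant_conv)
  then show ?thesis by (simp add: fibre_index_def)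
qed

lemma inj_on_coset_fibre: "inj_on (coset_fibre M) I"
  by (metis fibre_index_coset_fibre inj_onI)

context
  fixes M :: "'i \<Rightarrow> 'a set" and I :: "'i set"
  assumes subgroup: "\<And>i. i \<in> I \<Longrightarrow> subgroup (M i) G"
begin

lemma coset_space_iff:
  "(S, i) \<in> coset_space M I \<longleftrightarrow> i \<in> I \<and> (\<exists>g\<in>carrier G. S = g <#\<^bsub>G\<^esub> M i)"
  by (auto simp: coset_space_def coset_fibre_def)

lemma translation_coset:
  assumes "i \<in> I" "g \<in> carrier G" "h \<in> carrier G"
  shows "translation (coset_space M I) h (g <#\<^bsub>G\<^esub> M i, i) = ((h \<otimes> g) <#\<^bsub>G\<^esub> M i, i)"
  using assms subgroup.subset[OF subgroup]
  by (auto simp: translation_def coset_space_iff lcos_m_assoc)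

text \<open>
  Translation by \<open>h\<close> is a bijection because translation by its inverse undoes it. The same lemma gives
  the action on objects and the action on morphisms of the development.
\<close>

lemma translation_action: "group_action G (coset_space M I) (translation (coset_space M I))"
proof -
  let ?E = "coset_space M I"
  let ?t = "translation ?E"
  have mult: "?t h (?t k x) = ?t (h \<otimes> k) x" and closed: "?t h x \<in> ?E"
    if "h \<in> carrier G" "k \<in> carrier G" "x \<in> ?E" for h k x
    using that by (cases x; auto simp: coset_space_iff translation_coset m_assoc)+
  have one: "?t \<one> x = x" if "x \<in> ?E" for x
    using that by (cases x) (auto simp: coset_space_iff translation_coset)
  have Bij: "?t h \<in> Bij ?E" if h: "h \<in> carrier G" for h
  proof -
    have "bij_betw (?t h) ?E ?E"
      by (rule bij_betw_byWitness[where f' = "?t (inv h)"])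
        (use h closed[OF h h] closed[OF inv_closed[OF h] h] in \<open>auto simp: mult one\<close>)
    then show ?thesis by (simp add: Bij_def translation_def)
  qed
  have "?t (h \<otimes> k) = compose ?E (?t h) (?t k)" if "h \<in> carrier G" "k \<in> carrier G" for h k
  proof (rule extensionalityI[where A = ?E])
    show "?t (h \<otimes> k) \<in> extensional ?E" by (simp add: translation_def)
  qed (use that mult in \<open>auto simp: compose_eq\<close>)
  then have "?t \<in> hom G (BijGroup ?E)"
    using Bij by (auto simp: hom_def BijGroup_def)
  then show ?thesis
    by (intro group_action.intro group_hom.intro group_hom_axioms.intro is_group group_BijGroup)
qed

lemma orbit_translation:
  assumes "x \<in> coset_fibre M i" and "i \<in> I"
  shows "orbit G (translation (coset_space M I)) x = coset_fibre M i"
proof -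
  obtain g where g: "g \<in> carrier G" and x: "x = (g <#\<^bsub>G\<^esub> M i, i)"
    using assms by (auto simp: coset_fibre_def)
  have "(h <#\<^bsub>G\<^esub> M i, i) \<in> orbit G (translation (coset_space M I)) x" if "h \<in> carrier G" for h
  proof -
    have "(h <#\<^bsub>G\<^esub> M i, i) = translation (coset_space M I) (h \<otimes> inv g) x"
      using g assms that by (simp add: x translation_coset inv_solve_right m_assoc)
    then show ?thesis using g that by (auto simp: orbit_def)
  qed
  then show ?thesis
    using g assms by (auto simp: orbit_def coset_fibre_def x translation_coset)
qed

lemma orbits_translation:
  "orbits G (coset_space M I) (translation (coset_space M I)) = coset_fibre M ` I"
proof -
  have "coset_fibre M i \<in> orbits G (coset_space M I) (translation (coset_space M I))" if "i \<in> I" for i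
  proof -
    have x: "(\<one> <#\<^bsub>G\<^esub> M i, i) \<in> coset_fibre M i" by (simp add: coset_fibre_def)
    then have "(\<one> <#\<^bsub>G\<^esub> M i, i) \<in> coset_space M I" using that by (auto simp: coset_space_def)
    then show ?thesis using orbit_translation[OF x that] by (auto simp: orbits_def)
  qed
  moreover have "orbit G (translation (coset_space M I)) x \<in> coset_fibre M ` I"
    if x: "x \<in> coset_space M I" for x
  proof -
    obtain i where "i \<in> I" "x \<in> coset_fibre M i" using x by (auto simp: coset_space_def)
    then show ?thesis using orbit_translation by blast
  qed
  ultimately show ?thesis by (auto simp: orbits_def)
qed

lemma stabilizer_translation:
  assumes "i \<in> I"
  shows "stabilizer G (translation (coset_space M I)) (M i, i) = M i"
proof -
  interpret Mi: subgroup "M i" G using assms by (rule subgroup)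
  have one: "\<one> <#\<^bsub>G\<^esub> M i = M i" using Mi.subset by (rule lcos_mult_one)
  have "translation (coset_space M I) h (M i, i) = (h <#\<^bsub>G\<^esub> M i, i)" if "h \<in> carrier G" for h
    using translation_coset[OF assms one_closed that] that by (simp add: one)
  moreover have "h <#\<^bsub>G\<^esub> M i = M i \<longleftrightarrow> h \<in> M i" if "h \<in> carrier G" for h
    using l_coset_eq_iff[OF Mi.subgroup_axioms one_closed that] that by (auto simp: one)
  ultimately show ?thesis
    using Mi.subset by (auto simp: stabilizer_def)
qed

end

end

section \<open>The development of a scwol\<close>

text \<open>
  The data from which a development can be built. The condition \<open>e_conj\<close> makes the terminal object of a
  coset independent of its representative, and \<open>e_cmp\<close> makes terminal objects compatible with
  composition: \<open>e\<close> is multiplicative up to the subgroups \<open>L\<close>.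
\<close>

locale coset_system = scwol C + G: group G
  for C :: "('o, 'm) precategory" and G :: "'h monoid" (structure)
    and L :: "'o \<Rightarrow> 'h set" and e :: "'m \<Rightarrow> 'h" +
  assumes L_subgroup: "\<sigma> \<in> Obj C \<Longrightarrow> subgroup (L \<sigma>) G"
    and e_closed: "\<alpha> \<in> Mor C \<Longrightarrow> e \<alpha> \<in> carrier G"
    and e_Idn: "\<sigma> \<in> Obj C \<Longrightarrow> e (Idn C \<sigma>) = \<one>"
    and e_conj: "\<lbrakk>\<alpha> \<in> Mor C; x \<in> L (ini C \<alpha>)\<rbrakk> \<Longrightarrow> e \<alpha> \<otimes> x \<otimes> inv (e \<alpha>) \<in> L (ter C \<alpha>)"
    and e_cmp: "\<lbrakk>\<alpha> \<in> Mor C; \<beta> \<in> Mor C; ini C \<alpha> = ter C \<beta>\<rbrakk>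
      \<Longrightarrow> e \<alpha> \<otimes> e \<beta> \<otimes> inv (e (\<alpha> \<cdot>\<^bsub>C\<^esub> \<beta>)) \<in> L (ter C \<alpha>)"
begin

abbreviation L\<^sub>i :: "'m \<Rightarrow> 'h set"
  where "L\<^sub>i \<alpha> \<equiv> L (ini C \<alpha>)"

text \<open>
  The arrow \<open>(g L, \<alpha>)\<close> runs from \<open>(g L, ini \<alpha>)\<close> to \<open>(g (e \<alpha>)\<inverse> L', ter \<alpha>)\<close>, where \<open>L'\<close> is the subgroup
  at \<open>ter \<alpha>\<close>. The product of sets in \<open>ter\<close> gives this coset without choosing \<open>g\<close>; see \<open>ter_coset\<close>.
  A composite starts where its right factor does, and so carries the coset of that factor.
\<close>

definition development :: "('h set \<times> 'o, 'h set \<times> 'm) precategory"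
  where "development =
    \<lparr>Obj = G.coset_space L (Obj C),
     Mor = G.coset_space L\<^sub>i (Mor C),
     ini = (\<lambda>(S, \<alpha>). (S, ini C \<alpha>)),
     ter = (\<lambda>(S, \<alpha>). (S <#>\<^bsub>G\<^esub> (inv (e \<alpha>) <#\<^bsub>G\<^esub> L (ter C \<alpha>)), ter C \<alpha>)),
     Idn = (\<lambda>(S, \<sigma>). (S, Idn C \<sigma>)),
     cmp = (\<lambda>(S, \<alpha>) (T, \<beta>). (T, \<alpha> \<cdot>\<^bsub>C\<^esub> \<beta>))\<rparr>"

abbreviation X :: "('h set \<times> 'o, 'h set \<times> 'm) precategory"
  where "X \<equiv> development"

abbreviation act_obj :: "'h \<Rightarrow> 'h set \<times> 'o \<Rightarrow> 'h set \<times> 'o"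
  where "act_obj \<equiv> G.translation (G.coset_space L (Obj C))"

abbreviation act_mor :: "'h \<Rightarrow> 'h set \<times> 'm \<Rightarrow> 'h set \<times> 'm"
  where "act_mor \<equiv> G.translation (G.coset_space L\<^sub>i (Mor C))"

lemma L_ini_subgroup: "\<alpha> \<in> Mor C \<Longrightarrow> subgroup (L\<^sub>i \<alpha>) G"
  by (simp add: L_subgroup ini_closed)

lemma L_subset: "\<sigma> \<in> Obj C \<Longrightarrow> L \<sigma> \<subseteq> carrier G"
  using L_subgroup by (rule subgroup.subset)

lemma development_simps:
  "Obj X = G.coset_space L (Obj C)"
  "Mor X = G.coset_space L\<^sub>i (Mor C)"
  "ini X (S, \<alpha>) = (S, ini C \<alpha>)"
  "Idn X (S, \<sigma>) = (S, Idn C \<sigma>)"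
  "(S, \<alpha>) \<cdot>\<^bsub>X\<^esub> (T, \<beta>) = (T, \<alpha> \<cdot>\<^bsub>C\<^esub> \<beta>)"
  by (simp_all add: development_def)

lemma snd_ini: "snd (ini X a) = ini C (snd a)"
  by (simp add: development_def split: prod.split)

lemma snd_ter: "snd (ter X a) = ter C (snd a)"
  by (simp add: development_def split: prod.split)

lemma Obj_development_iff:
  "(S, \<sigma>) \<in> Obj X \<longleftrightarrow> \<sigma> \<in> Obj C \<and> (\<exists>g\<in>carrier G. S = g <#\<^bsub>G\<^esub> L \<sigma>)"
  unfolding development_simps by (rule G.coset_space_iff[OF L_subgroup])

lemma Mor_development_iff:
  "(S, \<alpha>) \<in> Mor X \<longleftrightarrow> \<alpha> \<in> Mor C \<and> (\<exists>g\<in>carrier G. S = g <#\<^bsub>G\<^esub> L\<^sub>i \<alpha>)"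
  unfolding development_simps by (rule G.coset_space_iff[OF L_ini_subgroup])

lemma act_obj_coset:
  "\<lbrakk>\<sigma> \<in> Obj C; g \<in> carrier G; h \<in> carrier G\<rbrakk>
    \<Longrightarrow> act_obj h (g <#\<^bsub>G\<^esub> L \<sigma>, \<sigma>) = ((h \<otimes> g) <#\<^bsub>G\<^esub> L \<sigma>, \<sigma>)"
  by (rule G.translation_coset[OF L_subgroup])

lemma act_mor_coset:
  "\<lbrakk>\<alpha> \<in> Mor C; g \<in> carrier G; h \<in> carrier G\<rbrakk>
    \<Longrightarrow> act_mor h (g <#\<^bsub>G\<^esub> L\<^sub>i \<alpha>, \<alpha>) = ((h \<otimes> g) <#\<^bsub>G\<^esub> L\<^sub>i \<alpha>, \<alpha>)"
  by (rule G.translation_coset[OF L_ini_subgroup])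

lemma ter_coset:
  assumes \<alpha>: "\<alpha> \<in> Mor C" and g: "g \<in> carrier G"
  shows "ter X (g <#\<^bsub>G\<^esub> L\<^sub>i \<alpha>, \<alpha>) = ((g \<otimes> inv (e \<alpha>)) <#\<^bsub>G\<^esub> L (ter C \<alpha>), ter C \<alpha>)"
proof -
  interpret i: subgroup "L\<^sub>i \<alpha>" G using \<alpha> by (rule L_ini_subgroup)
  interpret t: subgroup "L (ter C \<alpha>)" G using \<alpha> by (simp add: L_subgroup ter_closed)
  note e = e_closed[OF \<alpha>]
  have "(g <#\<^bsub>G\<^esub> L\<^sub>i \<alpha>) <#>\<^bsub>G\<^esub> (inv (e \<alpha>) <#\<^bsub>G\<^esub> L (ter C \<alpha>)) = (g \<otimes> inv (e \<alpha>)) <#\<^bsub>G\<^esub> L (ter C \<alpha>)"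
  proof (intro equalityI subsetI)
    fix z assume "z \<in> (g <#\<^bsub>G\<^esub> L\<^sub>i \<alpha>) <#>\<^bsub>G\<^esub> (inv (e \<alpha>) <#\<^bsub>G\<^esub> L (ter C \<alpha>))"
    then obtain x y where x: "x \<in> L\<^sub>i \<alpha>" and y: "y \<in> L (ter C \<alpha>)"
      and z: "z = (g \<otimes> x) \<otimes> (inv (e \<alpha>) \<otimes> y)"
      by (auto simp: set_mult_def l_coset_def)
    have "z = (g \<otimes> inv (e \<alpha>)) \<otimes> ((e \<alpha> \<otimes> x \<otimes> inv (e \<alpha>)) \<otimes> y)"
      using g e x y by (simp add: z G.m_assoc G.inv_mult_cancel)
    then show "z \<in> (g \<otimes> inv (e \<alpha>)) <#\<^bsub>G\<^esub> L (ter C \<alpha>)"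
      using e_conj[OF \<alpha> x] y by (auto simp: l_coset_def)
  next
    fix z assume "z \<in> (g \<otimes> inv (e \<alpha>)) <#\<^bsub>G\<^esub> L (ter C \<alpha>)"
    then obtain y where y: "y \<in> L (ter C \<alpha>)" and z: "z = (g \<otimes> inv (e \<alpha>)) \<otimes> y"
      by (auto simp: l_coset_def)
    have "z = (g \<otimes> \<one>) \<otimes> (inv (e \<alpha>) \<otimes> y)"
      using g e y by (simp add: z G.m_assoc)
    then show "z \<in> (g <#\<^bsub>G\<^esub> L\<^sub>i \<alpha>) <#>\<^bsub>G\<^esub> (inv (e \<alpha>) <#\<^bsub>G\<^esub> L (ter C \<alpha>))"
      using y i.one_closed by (auto simp: set_mult_def l_coset_def)
  qed
  then show ?thesis by (simp add: development_def)
qed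

text \<open>
  The one axiom with content is that a composite ends where its left factor does. It says that
  \<open>h (e (\<alpha> \<beta>))\<inverse>\<close> and \<open>h (e \<beta>)\<inverse> (e \<alpha>)\<inverse>\<close> represent the same coset, which is \<open>e_cmp\<close>.
\<close>

lemma category_development: "category X"
proof
  fix a b assume a: "a \<in> Mor X" and b: "b \<in> Mor X" and ab: "ini X a = ter X b"
  obtain \<alpha> where \<alpha>: "\<alpha> \<in> Mor C" and a_eq: "a = (fst a, \<alpha>)"
    using a by (cases a) (auto simp: Mor_development_iff)
  obtain h \<beta> where h: "h \<in> carrier G" and \<beta>: "\<beta> \<in> Mor C" and b_eq: "b = (h <#\<^bsub>G\<^esub> L\<^sub>i \<beta>, \<beta>)"
    using b by (cases b) (auto simp: Mor_development_iff)
  have "ini C \<alpha> = snd (ini X a)"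
    by (subst a_eq) (simp add: development_simps)
  then have \<alpha>\<beta>: "ini C \<alpha> = ter C \<beta>"
    unfolding ab snd_ter by (simp add: b_eq)
  have "fst a = (h \<otimes> inv (e \<beta>)) <#\<^bsub>G\<^esub> L\<^sub>i \<alpha>"
    using ab by (subst (asm) a_eq) (simp add: development_simps b_eq ter_coset \<beta> h \<alpha>\<beta>)
  then have a': "a = ((h \<otimes> inv (e \<beta>)) <#\<^bsub>G\<^esub> L\<^sub>i \<alpha>, \<alpha>)" using a_eq by simp
  have c: "\<alpha> \<cdot>\<^bsub>C\<^esub> \<beta> \<in> Mor C" "ini C (\<alpha> \<cdot>\<^bsub>C\<^esub> \<beta>) = ini C \<beta>" "ter C (\<alpha> \<cdot>\<^bsub>C\<^esub> \<beta>) = ter C \<alpha>"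
    using \<alpha> \<beta> \<alpha>\<beta> by (simp_all add: cmp_closed ini_cmp ter_cmp)
  have cmp: "a \<cdot>\<^bsub>X\<^esub> b = (h <#\<^bsub>G\<^esub> L\<^sub>i (\<alpha> \<cdot>\<^bsub>C\<^esub> \<beta>), \<alpha> \<cdot>\<^bsub>C\<^esub> \<beta>)"
    unfolding a' b_eq by (simp add: development_simps c)
  show "a \<cdot>\<^bsub>X\<^esub> b \<in> Mor X"
    unfolding cmp using c h by (auto simp: Mor_development_iff)
  show "ini X (a \<cdot>\<^bsub>X\<^esub> b) = ini X b"
    unfolding cmp by (simp add: development_simps b_eq c)
  have "(h \<otimes> inv (e (\<alpha> \<cdot>\<^bsub>C\<^esub> \<beta>))) <#\<^bsub>G\<^esub> L (ter C \<alpha>)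
      = (h \<otimes> inv (e \<beta>) \<otimes> inv (e \<alpha>)) <#\<^bsub>G\<^esub> L (ter C \<alpha>)"
  proof (rule G.l_coset_eq_iff[THEN iffD2, symmetric])
    have "inv (h \<otimes> inv (e \<beta>) \<otimes> inv (e \<alpha>)) \<otimes> (h \<otimes> inv (e (\<alpha> \<cdot>\<^bsub>C\<^esub> \<beta>)))
        = e \<alpha> \<otimes> e \<beta> \<otimes> inv (e (\<alpha> \<cdot>\<^bsub>C\<^esub> \<beta>))"
      using h e_closed[OF \<alpha>] e_closed[OF \<beta>] e_closed[OF c(1)]
      by (simp add: G.inv_mult_group G.m_assoc G.inv_mult_cancel)
    then show "inv (h \<otimes> inv (e \<beta>) \<otimes> inv (e \<alpha>)) \<otimes> (h \<otimes> inv (e (\<alpha> \<cdot>\<^bsub>C\<^esub> \<beta>))) \<in> L (ter C \<alpha>)"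
      using e_cmp[OF \<alpha> \<beta> \<alpha>\<beta>] by simp
  qed (use h \<alpha> \<beta> c e_closed in \<open>simp_all add: L_subgroup ter_closed\<close>)
  then show "ter X (a \<cdot>\<^bsub>X\<^esub> b) = ter X a"
    unfolding cmp using ter_coset[OF c(1) h] \<alpha> \<beta> h e_closed by (simp add: a' c ter_coset)
next
  fix a assume a: "a \<in> Mor X"
  then obtain g \<alpha> where g: "g \<in> carrier G" and \<alpha>: "\<alpha> \<in> Mor C" and a_eq: "a = (g <#\<^bsub>G\<^esub> L\<^sub>i \<alpha>, \<alpha>)"
    by (cases a) (auto simp: Mor_development_iff)
  show "ini X a \<in> Obj X"
    using g \<alpha> unfolding a_eq by (auto simp: development_simps(3) Obj_development_iff ini_closed)
  show "ter X a \<in> Obj X"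
    using g \<alpha> e_closed[OF \<alpha>] unfolding a_eq by (auto simp: ter_coset Obj_development_iff ter_closed)
  show "Idn X (ter X a) \<cdot>\<^bsub>X\<^esub> a = a"
    using g \<alpha> unfolding a_eq by (simp add: ter_coset development_simps Idn_left)
  show "a \<cdot>\<^bsub>X\<^esub> Idn X (ini X a) = a"
    using g \<alpha> unfolding a_eq by (simp add: development_simps Idn_right)
next
  fix x assume x: "x \<in> Obj X"
  then obtain g \<sigma> where g: "g \<in> carrier G" and \<sigma>: "\<sigma> \<in> Obj C" and x_eq: "x = (g <#\<^bsub>G\<^esub> L \<sigma>, \<sigma>)"
    by (cases x) (auto simp: Obj_development_iff)
  show "Idn X x \<in> Mor X"
    using g \<sigma> unfolding x_eq by (auto simp: development_simps(4) Mor_development_iff Idn_closed ini_Idn)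
  show "ini X (Idn X x) = x"
    using \<sigma> unfolding x_eq by (simp add: development_simps ini_Idn)
  have "Idn X x = (g <#\<^bsub>G\<^esub> L\<^sub>i (Idn C \<sigma>), Idn C \<sigma>)"
    using \<sigma> unfolding x_eq by (simp add: development_simps ini_Idn)
  then show "ter X (Idn X x) = x"
    using g \<sigma> by (simp add: ter_coset Idn_closed e_Idn ter_Idn x_eq)
next
  fix a b c assume abc: "a \<in> Mor X" "b \<in> Mor X" "c \<in> Mor X" "ini X a = ter X b" "ini X b = ter X c"
  have "snd a \<in> Mor C" "snd b \<in> Mor C" "snd c \<in> Mor C"
    using abc by (cases a; cases b; cases c; auto simp: Mor_development_iff)+
  moreover have "ini C (snd a) = ter C (snd b)" "ini C (snd b) = ter C (snd c)"
    using abc by (simp_all flip: snd_ini add: snd_ter)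
  ultimately show "a \<cdot>\<^bsub>X\<^esub> b \<cdot>\<^bsub>X\<^esub> c = a \<cdot>\<^bsub>X\<^esub> (b \<cdot>\<^bsub>X\<^esub> c)"
    by (cases a; cases b; cases c) (simp add: development_simps cmp_assoc)
qed

lemma Arr_development_iff: "(S, \<alpha>) \<in> Arr X \<longleftrightarrow> (S, \<alpha>) \<in> Mor X \<and> \<alpha> \<in> Arr C"
proof -
  have "(S, \<alpha>) \<in> Idn X ` Obj X \<longleftrightarrow> \<alpha> \<in> Idn C ` Obj C" if "(S, \<alpha>) \<in> Mor X"
  proof
    assume "(S, \<alpha>) \<in> Idn X ` Obj X"
    then show "\<alpha> \<in> Idn C ` Obj C"
      by (auto simp: development_simps(4) Obj_development_iff)
  next
    assume "\<alpha> \<in> Idn C ` Obj C"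
    then obtain \<sigma> where \<sigma>: "\<sigma> \<in> Obj C" "\<alpha> = Idn C \<sigma>" by blast
    then have "(S, \<sigma>) \<in> Obj X"
      using that by (simp add: Obj_development_iff Mor_development_iff ini_Idn)
    moreover have "(S, \<alpha>) = Idn X (S, \<sigma>)" using \<sigma> by (simp add: development_simps)
    ultimately show "(S, \<alpha>) \<in> Idn X ` Obj X" by blast
  qed
  then show ?thesis by (auto simp: Arr_def Mor_development_iff)
qed

text \<open>
  The development has neither loops nor cycles because it lies over \<open>C\<close>, and its identities are exactly
  the morphisms over identities.
\<close>

lemma scwol_development: "scwol X"
proof -
  interpret X: category X by (rule category_development)
  show ?thesis
  proof
    fix a assume a: "a \<in> Mor X" and loop: "ini X a = ter X a"
    have "ini C (snd a) = ter C (snd a)"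
      using loop by (simp flip: snd_ini snd_ter)
    moreover have "snd a \<in> Mor C"
      using a by (cases a) (simp add: Mor_development_iff)
    ultimately have "snd a = Idn C (ini C (snd a))" by (rule no_loops[rotated])
    then show "a = Idn X (ini X a)" by (cases a) (metis development_simps(3,4) snd_conv)
  next
    fix a b assume a: "a \<in> Arr X" and b: "b \<in> Arr X" and ab: "ini X a = ter X b"
    have Arr: "snd a \<in> Arr C" "snd b \<in> Arr C"
      using a b by (cases a; cases b; simp add: Arr_development_iff)+
    have "ini C (snd a) = ter C (snd b)"
      using ab by (simp flip: snd_ini snd_ter)
    then have "ini C (snd a \<cdot>\<^bsub>C\<^esub> snd b) \<noteq> ter C (snd a \<cdot>\<^bsub>C\<^esub> snd b)"
      using Arr by (simp add: no_cycles)
    moreover have "snd (a \<cdot>\<^bsub>X\<^esub> b) = snd a \<cdot>\<^bsub>C\<^esub> snd b"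
      by (cases a; cases b) (simp add: development_simps)
    ultimately have "snd (ini X (a \<cdot>\<^bsub>X\<^esub> b)) \<noteq> snd (ter X (a \<cdot>\<^bsub>X\<^esub> b))"
      by (simp add: snd_ini snd_ter)
    then show "ini X (a \<cdot>\<^bsub>X\<^esub> b) \<noteq> ter X (a \<cdot>\<^bsub>X\<^esub> b)" by metis
  qed
qed

text \<open>
  The action preserves the projection to \<open>C\<close>, where the ends of an arrow differ, so no arrow joins two
  points of an orbit. A morphism is determined by its initial object and its image in \<open>C\<close>, so fixing the
  initial object fixes the morphism.
\<close>

lemma scwol_action_development: "scwol_action G X act_obj act_mor"
proof -
  interpret X: scwol X by (rule scwol_development)
  interpret ao: group_action G "Obj X" act_obj
    unfolding development_simps by (rule G.translation_action[OF L_subgroup])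
  interpret am: group_action G "Mor X" act_mor
    unfolding development_simps by (rule G.translation_action[OF L_ini_subgroup])
  show ?thesis
  proof
    fix h assume h: "h \<in> carrier G"
    have ini_act: "ini X (act_mor h a) = act_obj h (ini X a)"
      and ter_act: "ter X (act_mor h a) = act_obj h (ter X a)" if a: "a \<in> Mor X" for a
    proof -
      obtain g \<alpha> where g: "g \<in> carrier G" and \<alpha>: "\<alpha> \<in> Mor C" and a_eq: "a = (g <#\<^bsub>G\<^esub> L\<^sub>i \<alpha>, \<alpha>)"
        using a by (cases a) (auto simp: Mor_development_iff)
      show "ini X (act_mor h a) = act_obj h (ini X a)"
        using g \<alpha> h ini_closed by (simp add: a_eq act_mor_coset act_obj_coset development_simps(3))
      show "ter X (act_mor h a) = act_obj h (ter X a)"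
        using g \<alpha> h ter_closed e_closed
        by (simp add: a_eq act_mor_coset act_obj_coset ter_coset G.m_assoc)
    qed
    have "act_mor h (Idn X x) = Idn X (act_obj h x)" if x: "x \<in> Obj X" for x
    proof -
      obtain g \<sigma> where g: "g \<in> carrier G" and \<sigma>: "\<sigma> \<in> Obj C" and x_eq: "x = (g <#\<^bsub>G\<^esub> L \<sigma>, \<sigma>)"
        using x by (cases x) (auto simp: Obj_development_iff)
      show ?thesis
        using act_mor_coset[OF Idn_closed[OF \<sigma>] g h] g \<sigma> h
        by (simp add: x_eq act_obj_coset development_simps(4) ini_Idn)
    qed
    moreover have "act_mor h (a \<cdot>\<^bsub>X\<^esub> b) = act_mor h a \<cdot>\<^bsub>X\<^esub> act_mor h b"
      if a: "a \<in> Mor X" and b: "b \<in> Mor X" and ab: "ini X a = ter X b" for a b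
    proof -
      have "a \<cdot>\<^bsub>X\<^esub> b \<in> Mor X" using that by (rule X.cmp_closed)
      then show ?thesis
        using a b unfolding development_simps(2)
        by (cases a; cases b) (simp add: G.translation_def development_simps(5))
    qed
    ultimately show "category_iso X X (act_obj h) (act_mor h)"
      using ao.bij_prop0[OF h] am.bij_prop0[OF h] ini_act ter_act
      by (simp add: category_iso_def Bij_def)
    have snd_act: "snd (act_obj h x) = snd x" if "x \<in> Obj X" for x
      using that by (cases x) (simp add: G.translation_def development_simps)
    fix a assume a: "a \<in> Arr X"
    then have a': "a \<in> Mor X" "snd a \<in> Arr C" "snd a \<in> Mor C"
      by (cases a; simp add: Arr_development_iff Mor_development_iff)+
    have "ini C (snd a) \<noteq> ter C (snd a)"
      using no_loops[OF a'(3)] a'(2) ini_closed[OF a'(3)] by (auto simp: Arr_def)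
    then show "act_obj h (ini X a) \<noteq> ter X a"
      using snd_act[OF X.ini_closed[OF a'(1)]] snd_ter[of a]
      by (cases a) (auto simp: development_simps(3))
    assume fix_ini: "act_obj h (ini X a) = ini X a"
    then have "ini X (act_mor h a) = ini X a" using ini_act a' by simp
    moreover have "snd (act_mor h a) = snd a"
      using a' by (cases a) (simp add: G.translation_def development_simps)
    ultimately show "act_mor h a = a"
      by (cases a; cases "act_mor h a") (simp add: development_simps)
  qed
qed


abbreviation Y :: "(('h set \<times> 'o) set, ('h set \<times> 'm) set) precategory"
  where "Y \<equiv> quotient_scwol G X act_obj act_mor"

abbreviation fibre_obj :: "'o \<Rightarrow> ('h set \<times> 'o) set"
  where "fibre_obj \<equiv> G.coset_fibre L"

abbreviation fibre_mor :: "'m \<Rightarrow> ('h set \<times> 'm) set"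
  where "fibre_mor \<equiv> G.coset_fibre L\<^sub>i"

lemma one_l_coset: "\<sigma> \<in> Obj C \<Longrightarrow> \<one> <#\<^bsub>G\<^esub> L \<sigma> = L \<sigma>"
  by (simp add: G.lcos_mult_one L_subset)

lemma Obj_quotient: "Obj Y = fibre_obj ` Obj C"
  unfolding quotient_scwol_def development_simps
  by (simp add: G.orbits_translation[OF L_subgroup])

lemma Mor_quotient: "Mor Y = fibre_mor ` Mor C"
  unfolding quotient_scwol_def development_simps
  by (simp add: G.orbits_translation[OF L_ini_subgroup])

lemma ini_quotient: "ini Y (fibre_mor \<alpha>) = fibre_obj (ini C \<alpha>)"
  by (simp add: quotient_scwol_def G.coset_fibre_def image_image development_simps(3))

text \<open>
  Right multiplication by \<open>(e \<alpha>)\<inverse>\<close> permutes \<open>G\<close>, so terminal objects fill the whole fibre.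
\<close>

lemma ter_quotient:
  assumes \<alpha>: "\<alpha> \<in> Mor C"
  shows "ter Y (fibre_mor \<alpha>) = fibre_obj (ter C \<alpha>)"
proof -
  have "(\<lambda>g. g \<otimes> inv (e \<alpha>)) ` carrier G = carrier G"
  proof (intro equalityI subsetI)
    fix g assume "g \<in> carrier G"
    then have "g = (g \<otimes> e \<alpha>) \<otimes> inv (e \<alpha>)" "g \<otimes> e \<alpha> \<in> carrier G"
      using e_closed[OF \<alpha>] by (simp_all add: G.m_assoc)
    then show "g \<in> (\<lambda>g. g \<otimes> inv (e \<alpha>)) ` carrier G" by blast
  qed (use e_closed[OF \<alpha>] in auto)
  then have "fibre_obj (ter C \<alpha>)
      = (\<lambda>g. ((g \<otimes> inv (e \<alpha>)) <#\<^bsub>G\<^esub> L (ter C \<alpha>), ter C \<alpha>)) ` carrier G"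
    unfolding G.coset_fibre_def by (metis (no_types, lifting) image_cong image_image)
  also have "\<dots> = ter X ` fibre_mor \<alpha>"
    unfolding G.coset_fibre_def image_image by (rule image_cong) (simp_all add: ter_coset \<alpha>)
  finally show ?thesis by (simp add: quotient_scwol_def)
qed

lemma Idn_quotient: "\<sigma> \<in> Obj C \<Longrightarrow> Idn Y (fibre_obj \<sigma>) = fibre_mor (Idn C \<sigma>)"
  by (simp add: quotient_scwol_def G.coset_fibre_def image_image development_simps(4) ini_Idn)

text \<open>
  Every morphism over \<open>\<alpha> \<beta>\<close> is a composite: its coset determines the factor over \<open>\<beta>\<close>, whose terminal
  object then determines the factor over \<open>\<alpha>\<close>.
\<close>

lemma cmp_quotient:
  assumes \<alpha>: "\<alpha> \<in> Mor C" and \<beta>: "\<beta> \<in> Mor C" and \<alpha>\<beta>: "ini C \<alpha> = ter C \<beta>"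
  shows "fibre_mor \<alpha> \<cdot>\<^bsub>Y\<^esub> fibre_mor \<beta> = fibre_mor (\<alpha> \<cdot>\<^bsub>C\<^esub> \<beta>)"
proof -
  have ini: "ini C (\<alpha> \<cdot>\<^bsub>C\<^esub> \<beta>) = ini C \<beta>" using assms by (rule ini_cmp)
  have "\<exists>a b. z = a \<cdot>\<^bsub>X\<^esub> b \<and> a \<in> fibre_mor \<alpha> \<and> b \<in> fibre_mor \<beta> \<and> ini X a = ter X b"
    if z_in: "z \<in> fibre_mor (\<alpha> \<cdot>\<^bsub>C\<^esub> \<beta>)" for z
  proof -
    obtain h where h: "h \<in> carrier G" and z: "z = (h <#\<^bsub>G\<^esub> L\<^sub>i \<beta>, \<alpha> \<cdot>\<^bsub>C\<^esub> \<beta>)"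
      using z_in by (auto simp: G.coset_fibre_def ini)
    let ?a = "((h \<otimes> inv (e \<beta>)) <#\<^bsub>G\<^esub> L\<^sub>i \<alpha>, \<alpha>)" and ?b = "(h <#\<^bsub>G\<^esub> L\<^sub>i \<beta>, \<beta>)"
    have "z = ?a \<cdot>\<^bsub>X\<^esub> ?b" by (simp add: z development_simps(5))
    moreover have "?a \<in> fibre_mor \<alpha>" "?b \<in> fibre_mor \<beta>"
      using h e_closed[OF \<beta>] by (auto simp: G.coset_fibre_def)
    moreover have "ini X ?a = ter X ?b"
      using h \<beta> \<alpha>\<beta> by (simp add: ter_coset development_simps(3))
    ultimately show ?thesis by blast
  qed
  moreover have "a \<cdot>\<^bsub>X\<^esub> b \<in> fibre_mor (\<alpha> \<cdot>\<^bsub>C\<^esub> \<beta>)" if "a \<in> fibre_mor \<alpha>" "b \<in> fibre_mor \<beta>" for a b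
    using that by (auto simp: G.coset_fibre_def development_simps(5) ini)
  ultimately show ?thesis by (auto simp: quotient_scwol_def)
qed

lemma category_iso_quotient: "category_iso C Y fibre_obj fibre_mor"
  by (simp add: category_iso_def bij_betw_def G.inj_on_coset_fibre Obj_quotient Mor_quotient
      ini_quotient ter_quotient Idn_quotient cmp_quotient)

lemma Arr_quotient: "Arr Y = fibre_mor ` Arr C"
proof -
  have "Idn Y ` Obj Y = fibre_mor ` (Idn C ` Obj C)"
    unfolding Obj_quotient image_image by (rule image_cong) (simp_all add: Idn_quotient)
  then show ?thesis
    unfolding Arr_def Mor_quotient
    using inj_on_image_set_diff[OF G.inj_on_coset_fibre subset_UNIV subset_UNIV] by metis
qed

text \<open>
  The choices for the associated complex are the trivial cosets and the elements \<open>e\<close>. By \<open>ter_coset\<close> the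
  arrow from the trivial coset over \<open>\<alpha>\<close> ends at the coset of \<open>(e \<alpha>)\<inverse>\<close>, which \<open>e \<alpha>\<close> carries to the
  trivial one.
\<close>

definition base_obj :: "('h set \<times> 'o) set \<Rightarrow> 'h set \<times> 'o"
  where "base_obj S = (L (G.fibre_index S), G.fibre_index S)"

definition base_mor :: "('h set \<times> 'm) set \<Rightarrow> 'h set \<times> 'm"
  where "base_mor A = (L\<^sub>i (G.fibre_index A), G.fibre_index A)"

definition base_elt :: "('h set \<times> 'm) set \<Rightarrow> 'h"
  where "base_elt A = e (G.fibre_index A)"

lemma base_fibre:
  "base_obj (fibre_obj \<sigma>) = (L \<sigma>, \<sigma>)"
  "base_mor (fibre_mor \<alpha>) = (L\<^sub>i \<alpha>, \<alpha>)"
  "base_elt (fibre_mor \<alpha>) = e \<alpha>"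
  by (simp_all add: base_obj_def base_mor_def base_elt_def G.fibre_index_coset_fibre)

lemma action_choices_development:
  "action_choices G X act_obj act_mor base_obj base_mor base_elt"
proof (rule action_choices.intro[OF scwol_action_development], rule action_choices_axioms.intro)
  have in_fibre: "(L \<sigma>, \<sigma>) \<in> fibre_obj \<sigma>" if "\<sigma> \<in> Obj C" for \<sigma>
    using one_l_coset[OF that] G.one_closed unfolding G.coset_fibre_def by force
  fix S assume "S \<in> Obj Y"
  then show "base_obj S \<in> S"
    by (auto simp: Obj_quotient base_fibre in_fibre)
next
  fix A assume "A \<in> Arr Y"
  then obtain \<alpha> where A: "A = fibre_mor \<alpha>" and \<alpha>: "\<alpha> \<in> Mor C"
    unfolding Arr_quotient by (auto simp: Arr_def)
  note I = ini_closed[OF \<alpha>] and T = ter_closed[OF \<alpha>]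
  have base: "base_mor A = (\<one> <#\<^bsub>G\<^esub> L\<^sub>i \<alpha>, \<alpha>)"
    by (simp add: A base_fibre one_l_coset I)
  show "base_mor A \<in> A"
    unfolding base by (simp add: A G.coset_fibre_def)
  show "ini X (base_mor A) = base_obj (ini Y A)"
    by (simp add: A base_fibre ini_quotient development_simps(3))
  show "base_elt A \<in> carrier G"
    using \<alpha> by (simp add: A base_fibre e_closed)
  have "act_obj (base_elt A) (ter X (base_mor A)) = (\<one> <#\<^bsub>G\<^esub> L (ter C \<alpha>), ter C \<alpha>)"
    using \<alpha> T e_closed[OF \<alpha>] unfolding base
    by (simp add: A base_fibre ter_coset act_obj_coset)
  then show "act_obj (base_elt A) (ter X (base_mor A)) = base_obj (ter Y A)"
    using \<alpha> T by (simp add: A base_fibre ter_quotient one_l_coset)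
qed

lemma stabilizer_base_obj:
  "\<sigma> \<in> Obj C \<Longrightarrow> stabilizer G act_obj (base_obj (fibre_obj \<sigma>)) = L \<sigma>"
  unfolding base_fibre by (rule G.stabilizer_translation[OF L_subgroup])

end

section \<open>Morphisms injective on local groups give developability\<close>

context complex_morphism_to_group
begin

abbreviation img :: "'o \<Rightarrow> 'h set"
  where "img \<sigma> \<equiv> \<phi> \<sigma> ` carrier (lgrp \<Lambda> \<sigma>)"

text \<open>
  The two membership conditions are the relations \<open>e_conj\<close> and \<open>e_cmp\<close>, which identify the elements in
  question as the images of \<open>psi_ext\<close> and \<open>twist_ext\<close>.
\<close>

lemma coset_system_img: "coset_system C G img e"
proof (intro coset_system.intro coset_system_axioms.intro)
  show "subgroup (img \<sigma>) G" if "\<sigma> \<in> Obj C" for \<sigma>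
    using that group_hom.img_is_subgroup[of "lgrp \<Lambda> \<sigma>" G "\<phi> \<sigma>"] \<phi>.hom lgrp_group
    by (simp add: group_hom_def group_hom_axioms_def)
  show "e \<alpha> \<otimes> x \<otimes> inv (e \<alpha>) \<in> img (ter C \<alpha>)" if \<alpha>: "\<alpha> \<in> Mor C" and x: "x \<in> img (ini C \<alpha>)" for \<alpha> x
  proof -
    obtain g where g: "g \<in> carrier (lgrp \<Lambda> (ini C \<alpha>))" and x_eq: "x = \<phi> (ini C \<alpha>) g" using x by blast
    have p: "psi_ext \<Lambda> \<alpha> g \<in> carrier (lgrp \<Lambda> (ter C \<alpha>))" using \<alpha> g by (rule psi_ext_closed)
    have "e \<alpha> \<otimes> x \<otimes> inv (e \<alpha>) = \<phi> (ter C \<alpha>) (psi_ext \<Lambda> \<alpha> g)"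
      using local_closed[OF base.ter_closed[OF \<alpha>] p] e_closed[OF \<alpha>]
      by (simp add: x_eq \<phi>.m_assoc flip: e_conj[OF \<alpha> g])
    then show ?thesis using p by blast
  qed
  show "e \<alpha> \<otimes> e \<beta> \<otimes> inv (e (\<alpha> \<cdot>\<^bsub>C\<^esub> \<beta>)) \<in> img (ter C \<alpha>)"
    if \<alpha>: "\<alpha> \<in> Mor C" and \<beta>: "\<beta> \<in> Mor C" and \<alpha>\<beta>: "ini C \<alpha> = ter C \<beta>" for \<alpha> \<beta>
  proof -
    have t: "twist_ext \<Lambda> \<alpha> \<beta> \<in> carrier (lgrp \<Lambda> (ter C \<alpha>))" using that by (rule twist_ext_closed)
    have "e \<alpha> \<otimes> e \<beta> \<otimes> inv (e (\<alpha> \<cdot>\<^bsub>C\<^esub> \<beta>)) = \<phi> (ter C \<alpha>) (twist_ext \<Lambda> \<alpha> \<beta>)"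
      using local_closed[OF base.ter_closed[OF \<alpha>] t] e_closed[OF base.cmp_closed[OF that]]
      by (simp add: \<phi>.m_assoc flip: e_cmp[OF that])
    then show ?thesis using t by blast
  qed
qed (simp_all add: e_closed e_Idn base.scwol_axioms \<phi>.is_group)

text \<open>
  The local isomorphisms are the maps \<open>\<phi>\<close> onto their images, which are the stabilizers. Since the
  choices \<open>e\<close> are the values of \<open>\<phi>\<close> on arrows, the structure maps and twisting elements already agree,
  and the arrow component of the isomorphism can be trivial.
\<close>

theorem injective_imp_developable:
  assumes inj: "injective_on_local_groups \<Lambda> \<phi>"
  shows "developable TYPE('h) \<Lambda>"
proof -
  interpret D: coset_system C G img e by (rule coset_system_img)
  let ?\<Lambda>' = "associated_complex G D.X D.act_obj D.act_mor D.base_obj D.base_elt"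
  have base': "base ?\<Lambda>' = D.Y"
    and psi': "psi ?\<Lambda>' (D.fibre_mor a) = Ad G (e a)"
    and twist': "twist ?\<Lambda>' (D.fibre_mor a) (D.fibre_mor b)
      = e a \<otimes> e b \<otimes> inv (D.base_elt (D.fibre_mor a \<cdot>\<^bsub>D.Y\<^esub> D.fibre_mor b))" for a b
    by (simp_all add: associated_complex_def D.base_fibre)
  have lgrp': "lgrp ?\<Lambda>' (D.fibre_obj \<sigma>) = G\<lparr>carrier := img \<sigma>\<rparr>" if "\<sigma> \<in> Obj C" for \<sigma>
    using that by (simp add: associated_complex_def D.stabilizer_base_obj)
  have "complex_iso \<Lambda> ?\<Lambda>' D.fibre_obj D.fibre_mor \<phi> (\<lambda>_. \<one>)"
    unfolding complex_iso_def Let_def base' C_def[symmetric]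
  proof (intro conjI ballI impI)
    show "category_iso C D.Y D.fibre_obj D.fibre_mor" by (rule D.category_iso_quotient)
  next
    fix \<sigma> assume \<sigma>: "\<sigma> \<in> Obj C"
    then have "inj_on (\<phi> \<sigma>) (carrier (lgrp \<Lambda> \<sigma>))"
      using inj by (simp add: injective_on_local_groups_def flip: C_def)
    then show "\<phi> \<sigma> \<in> iso (lgrp \<Lambda> \<sigma>) (lgrp ?\<Lambda>' (D.fibre_obj \<sigma>))"
      using \<sigma> local_mult by (simp add: lgrp' iso_def hom_def bij_betw_def)
  next
    fix a assume "a \<in> Arr C"
    then have T: "ter C a \<in> Obj C" by (simp add: base.Arr_imp_Mor base.ter_closed)
    interpret t: subgroup "img (ter C a)" G using T by (rule D.L_subgroup)
    show "\<one> \<in> carrier (lgrp ?\<Lambda>' (D.fibre_obj (ter C a)))"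
      using t.one_closed by (simp add: lgrp' T)
  next
    fix a g assume a': "a \<in> Arr C" and g: "g \<in> carrier (lgrp \<Lambda> (ini C a))"
    then have a: "a \<in> Mor C" and T: "ter C a \<in> Obj C" by (simp_all add: base.Arr_imp_Mor base.ter_closed)
    interpret t: subgroup "img (ter C a)" G using T by (rule D.L_subgroup)
    interpret H: group "G\<lparr>carrier := img (ter C a)\<rparr>" by (rule t.subgroup_is_group) (rule \<phi>.is_group)
    have "psi \<Lambda> a g \<in> carrier (lgrp \<Lambda> (ter C a))"
      using psi_ext_closed[OF a g] a' by (simp add: psi_ext_def flip: C_def)
    then have "\<one> \<otimes> \<phi> (ter C a) (psi \<Lambda> a g) \<otimes> \<one> = \<phi> (ter C a) (psi \<Lambda> a g)"
      using local_closed[OF T] by simp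
    then show "Ad (lgrp ?\<Lambda>' (D.fibre_obj (ter C a))) \<one> (psi ?\<Lambda>' (D.fibre_mor a) (\<phi> (ini C a) g))
        = \<phi> (ter C a) (psi \<Lambda> a g)"
      using H.inv_one \<phi>.arr_conj[OF a' g]
      by (simp add: lgrp' T psi' Ad_def e_Arr a')
  next
    fix a b assume a': "a \<in> Arr C" and b': "b \<in> Arr C" and ab: "ini C a = ter C b"
    then have a: "a \<in> Mor C" and b: "b \<in> Mor C" and T: "ter C a \<in> Obj C"
      by (simp_all add: base.Arr_imp_Mor base.ter_closed)
    have ab': "a \<cdot>\<^bsub>C\<^esub> b \<in> Arr C" using a' b' ab by (rule base.Arr_cmp)
    note closed = \<phi>.arr_closed[OF a'] \<phi>.arr_closed[OF b'] \<phi>.arr_closed[OF ab']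
      local_closed[OF T twist_closed[OF a' b' ab]]
    have "\<phi> (ter C a) (twist \<Lambda> a b) = \<phi>a a \<otimes> \<phi>a b \<otimes> inv \<phi>a (a \<cdot>\<^bsub>C\<^esub> b)"
      using closed by (simp add: \<phi>.m_assoc flip: \<phi>.arr_cmp[OF a' b' ab])
    then show "\<phi> (ter C a) (twist \<Lambda> a b) \<otimes>\<^bsub>lgrp ?\<Lambda>' (D.fibre_obj (ter C a))\<^esub> \<one>
        = \<one> \<otimes>\<^bsub>lgrp ?\<Lambda>' (D.fibre_obj (ter C a))\<^esub> psi ?\<Lambda>' (D.fibre_mor a) \<one>
          \<otimes>\<^bsub>lgrp ?\<Lambda>' (D.fibre_obj (ter C a))\<^esub> twist ?\<Lambda>' (D.fibre_mor a) (D.fibre_mor b)"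
      using closed by (simp add: lgrp' T psi' twist' D.cmp_quotient a b ab D.base_fibre e_Arr a' b' ab' Ad_def)
  qed
  then show ?thesis
    unfolding developable_def using D.action_choices_development by blast
qed

end

section \<open>Sheaves and functors to a general linear group\<close>

lemma (in complex_of_groups) witness_imp_sheaf:
  assumes "vectorspace K V" and "vectorspace.fin_dim K V" and "witnesses (GL K V) \<Lambda>"
  shows "\<exists>Fm. sheaf K (BH_category \<Lambda>) (\<lambda>_. V) Fm \<and> dev_properties K \<Lambda> (\<lambda>_. V) Fm"
proof -
  interpret V: vectorspace K V by fact
  obtain \<phi> \<phi>a where "morphism_to_group \<Lambda> (GL K V) \<phi> \<phi>a" and inj: "injective_on_local_groups \<Lambda> \<phi>"
    using assms(3) by (auto simp: witnesses_def)
  then interpret M: complex_morphism_to_group \<Lambda> C "GL K V" \<phi> \<phi>a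
    unfolding C_def by (intro complex_morphism_to_group.intro) (simp_all add: complex_of_groups_axioms)
  let ?D = "BH_category \<Lambda>"
  define Fm where "Fm = (\<lambda>(g, \<alpha>). \<phi> (ter C \<alpha>) g \<otimes>\<^bsub>GL K V\<^esub> M.e \<alpha>)"
  have Fm: "functor_to_group ?D (GL K V) Fm"
    unfolding Fm_def by (rule M.functor_BH_category)
  have Fm_GL: "Fm l \<in> carrier (GL K V)" if "l \<in> Mor ?D" for l
    using Fm that by (auto simp: functor_to_group_def)
  have Fm_local: "Fm (g, Idn C \<sigma>) = \<phi> \<sigma> g" if "\<sigma> \<in> Obj C" "g \<in> carrier (lgrp \<Lambda> \<sigma>)" for \<sigma> g
    using that by (simp add: Fm_def base.ter_Idn M.e_Idn M.local_closed)
  have "sheaf K ?D (\<lambda>_. V) Fm"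
  proof
    fix x assume "x \<in> Obj ?D"
    then have x: "x \<in> Obj C" by (simp add: BH_simps flip: C_def)
    interpret x: group "lgrp \<Lambda> x" using x by (rule lgrp_group)
    show "Fm (Idn ?D x) = (\<lambda>v\<in>carrier V. v)"
      using x by (simp add: BH_simps Fm_local M.local_one GL_one flip: C_def)
  next
    fix l m assume l: "l \<in> Mor ?D" and m: "m \<in> Mor ?D" and lm: "ini ?D l = ter ?D m"
    have "Fm (l \<cdot>\<^bsub>?D\<^esub> m) = Fm l \<otimes>\<^bsub>GL K V\<^esub> Fm m"
      using Fm l m lm by (simp add: functor_to_group_def)
    then show "Fm (l \<cdot>\<^bsub>?D\<^esub> m) = compose (carrier V) (Fm l) (Fm m)"
      using Fm_GL l m by (simp add: GL_mult)
  qed (use V.vectorspace_axioms subsetD[OF GL_subset_Lin Fm_GL] in simp_all)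
  moreover have "dev_properties K \<Lambda> (\<lambda>_. V) Fm"
    unfolding dev_properties_def Let_def endos_def[symmetric]
  proof (intro conjI exI ballI)
    fix l assume "l \<in> Mor ?D"
    then show "Lin_invertible K V V (Fm l)"
      by (intro GL_imp_Lin_invertible V.module_axioms Fm_GL)
  next
    fix \<sigma> assume "\<sigma> \<in> Obj ?D"
    then have \<sigma>: "\<sigma> \<in> Obj C" by (simp add: BH_simps flip: C_def)
    then have "inj_on (\<phi> \<sigma>) (carrier (lgrp \<Lambda> \<sigma>))"
      using inj by (simp add: injective_on_local_groups_def flip: C_def)
    then show "inj_on Fm (endos ?D \<sigma>)"
      by (simp add: inj_on_endos_BH_category[OF \<sigma>] Fm_local[OF \<sigma>] cong: inj_on_cong)
  qed (use assms(2) in simp_all)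
  ultimately show ?thesis by blast
qed

lemma (in complex_of_groups) faithful_functor_imp_witnesses:
  fixes G :: "'h monoid"
  assumes G: "group G" and \<Phi>: "functor_to_group (BH_category \<Lambda>) G \<Phi>"
    and inj: "\<And>\<sigma>. \<sigma> \<in> Obj C \<Longrightarrow> inj_on \<Phi> (endos (BH_category \<Lambda>) \<sigma>)"
  shows "witnesses G \<Lambda>"
proof -
  let ?\<phi> = "\<lambda>\<sigma> g. \<Phi> (g, Idn C \<sigma>)" and ?\<phi>a = "\<lambda>a. \<Phi> (\<one>\<^bsub>lgrp \<Lambda> (ter C a)\<^esub>, a)"
  have morphism: "morphism_to_group \<Lambda> G ?\<phi> ?\<phi>a"
    using G \<Phi> by (rule functor_imp_morphism)
  then interpret M: complex_morphism_to_group \<Lambda> C G ?\<phi> ?\<phi>a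
    unfolding C_def by (intro complex_morphism_to_group.intro) (simp_all add: complex_of_groups_axioms)
  have local: "injective_on_local_groups \<Lambda> ?\<phi>"
    using inj by (simp add: injective_on_local_groups_def inj_on_endos_BH_category flip: C_def)
  then show ?thesis
    using morphism M.injective_imp_developable unfolding witnesses_def by blast
qed

text \<open>
  Conjugation by the chosen isomorphisms \<open>f\<close> respects composition because the two copies of \<open>f\<close> at the
  middle object cancel, and it loses no information, since a sheaf map is extensional and \<open>f\<close> is
  bijective.
\<close>

lemma (in complex_of_groups) functor_of_sheaf:
  defines "D \<equiv> BH_category \<Lambda>"
  assumes V: "vectorspace K V" and sheaf: "sheaf K D Fo Fm"
    and invertible: "\<And>l. l \<in> Mor D \<Longrightarrow> Lin_invertible K (Fo (ini D l)) (Fo (ter D l)) (Fm l)"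
    and f: "\<And>x. x \<in> Obj D \<Longrightarrow> f x \<in> module_hom K (Fo x) V"
    and f_bij: "\<And>x. x \<in> Obj D \<Longrightarrow> bij_betw (f x) (carrier (Fo x)) (carrier V)"
  defines "\<Phi> \<equiv> \<lambda>l. \<lambda>v\<in>carrier V. f (ter D l) (Fm l (inv_into (carrier (Fo (ini D l))) (f (ini D l)) v))"
  shows "functor_to_group D (GL K V) \<Phi>"
    and "\<And>x. \<lbrakk>x \<in> Obj D; inj_on Fm (endos D x)\<rbrakk> \<Longrightarrow> inj_on \<Phi> (endos D x)"
proof -
  note ends = BH_ends[folded D_def] and cmp_ends = BH_cmp_ends[folded D_def]
  interpret F: sheaf K D Fo Fm by fact
  interpret V: vectorspace K V by fact
  let ?g = "\<lambda>x. inv_into (carrier (Fo x)) (f x)"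
  have F_module: "module K (Fo x)" if "x \<in> Obj D" for x
    using F.vectorspace[OF that] by (simp add: vectorspace_def)
  have g_bij: "bij_betw (?g x) (carrier V) (carrier (Fo x))" if "x \<in> Obj D" for x
    using f_bij[OF that] by (rule bij_betw_inv_into)
  have gf: "?g x (f x u) = u" if "x \<in> Obj D" "u \<in> carrier (Fo x)" for x u
    using f_bij[OF that(1)] that(2) by (rule bij_betw_inv_into_left)
  have fg: "f x (?g x v) = v" if "x \<in> Obj D" "v \<in> carrier V" for x v
    using f_bij[OF that(1)] that(2) by (rule bij_betw_inv_into_right)
  have g_closed: "?g x v \<in> carrier (Fo x)" if "x \<in> Obj D" "v \<in> carrier V" for x v
    using g_bij[OF that(1)] that(2) by (rule bij_betw_apply)
  have F_bij: "bij_betw (Fm l) (carrier (Fo (ini D l))) (carrier (Fo (ter D l)))" if "l \<in> Mor D" for l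
    using Lin_invertible_imp_bij_betw[OF F.Lin[OF that] invertible[OF that]] .
  have F_closed: "Fm l u \<in> carrier (Fo (ter D l))" if "l \<in> Mor D" "u \<in> carrier (Fo (ini D l))" for l u
    using F_bij[OF that(1)] that(2) by (rule bij_betw_apply)
  have \<Phi>_GL: "\<Phi> l \<in> carrier (GL K V)" if l: "l \<in> Mor D" for l
  proof -
    have i: "ini D l \<in> Obj D" and t: "ter D l \<in> Obj D"
      using l by (rule ends(1), rule ends(2))
    let ?h = "\<lambda>v\<in>carrier V. ?g (ini D l) v"
    have h: "?h \<in> module_hom K V (Fo (ini D l))"
      using F_module[OF i] f[OF i] f_bij[OF i] by (rule module_hom_inv_into)
    have "compose (carrier V) (Fm l) ?h \<in> module_hom K V (Fo (ter D l))"
      using module_hom_compose[OF V.module_axioms _ h, of "Fm l" "Fo (ter D l)"] F.Lin[OF l]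
      by (simp add: Lin_def)
    then have "compose (carrier V) (f (ter D l)) (compose (carrier V) (Fm l) ?h) \<in> module_hom K V V"
      by (rule module_hom_compose[OF V.module_axioms f[OF t]])
    also have "compose (carrier V) (f (ter D l)) (compose (carrier V) (Fm l) ?h) = \<Phi> l"
      by (auto simp: compose_def \<Phi>_def)
    finally have "\<Phi> l \<in> module_hom K V V" .
    moreover have "bij_betw (\<Phi> l) (carrier V) (carrier V)"
    proof -
      have "bij_betw (f (ter D l) \<circ> (Fm l \<circ> ?g (ini D l))) (carrier V) (carrier V)"
        using g_bij[OF i] F_bij[OF l] f_bij[OF t] by (blast intro: bij_betw_trans)
      then show ?thesis
        by (rule bij_betw_cong[THEN iffD1, rotated]) (simp add: \<Phi>_def)
    qed
    moreover have "\<Phi> l \<in> extensional (carrier V)" by (simp add: \<Phi>_def)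
    ultimately show ?thesis by (simp add: GL_carrier Bij_def)
  qed
  show "functor_to_group D (GL K V) \<Phi>"
    unfolding functor_to_group_def
  proof (intro conjI ballI impI funcsetI)
    fix l m assume l: "l \<in> Mor D" and m: "m \<in> Mor D" and lm: "ini D l = ter D m"
    note i = ends(1)[OF m] and t = ends(2)[OF m]
    have "\<Phi> (l \<cdot>\<^bsub>D\<^esub> m) v = \<Phi> l (\<Phi> m v)" if v: "v \<in> carrier V" for v
    proof -
      have u: "?g (ini D m) v \<in> carrier (Fo (ini D m))" using i v by (rule g_closed)
      have w: "Fm m (?g (ini D m) v) \<in> carrier (Fo (ter D m))" using m u by (rule F_closed)
      have "f (ter D m) (Fm m (?g (ini D m) v)) \<in> carrier V"
        using f_bij[OF t] w by (rule bij_betw_apply)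
      then show ?thesis
        using v u gf[OF t w]
        by (simp add: \<Phi>_def cmp_ends[OF l m lm] F.map_cmp[OF l m lm] compose_eq lm)
    qed
    then have "\<Phi> (l \<cdot>\<^bsub>D\<^esub> m) = compose (carrier V) (\<Phi> l) (\<Phi> m)"
      by (intro extensionalityI[where A = "carrier V"]) (simp_all add: \<Phi>_def compose_eq)
    then show "\<Phi> (l \<cdot>\<^bsub>D\<^esub> m) = \<Phi> l \<otimes>\<^bsub>GL K V\<^esub> \<Phi> m"
      using \<Phi>_GL l m by (simp add: GL_mult)
  qed (rule \<Phi>_GL)
  fix x assume x: "x \<in> Obj D" and inj: "inj_on Fm (endos D x)"
  show "inj_on \<Phi> (endos D x)"
  proof (rule inj_onI)
    fix l m assume l: "l \<in> endos D x" and m: "m \<in> endos D x" and eq: "\<Phi> l = \<Phi> m"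
    have lm: "l \<in> Mor D" "ini D l = x" "ter D l = x" "m \<in> Mor D" "ini D m = x" "ter D m = x"
      using l m by (simp_all add: endos_def)
    have "Fm l u = Fm m u" if u: "u \<in> carrier (Fo x)" for u
    proof -
      have fu: "f x u \<in> carrier V" using f_bij[OF x] u by (rule bij_betw_apply)
      then have "f x (Fm l u) = f x (Fm m u)"
        using fun_cong[OF eq, of "f x u"] lm gf[OF x u] by (simp add: \<Phi>_def)
      moreover have "Fm l u \<in> carrier (Fo x)" "Fm m u \<in> carrier (Fo x)"
        using F_closed[of l u] F_closed[of m u] lm u by simp_all
      ultimately show ?thesis
        using gf[OF x] by metis
    qed
    moreover have "Fm l \<in> extensional (carrier (Fo x))" "Fm m \<in> extensional (carrier (Fo x))"
      using F.Lin[of l] F.Lin[of m] lm by (simp_all add: Lin_def)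
    ultimately have "Fm l = Fm m" by (meson extensionalityI)
    then show "l = m" using inj l m by (simp add: inj_onD)
  qed
qed

lemma (in complex_of_groups) sheaf_imp_witness:
  assumes K: "field (K :: ('k, 'r) ring_scheme)"
    and sheaf: "sheaf K (BH_category \<Lambda>) (Fo :: 'o \<Rightarrow> ('k, 'v) module) Fm" and dev: "dev_properties K \<Lambda> Fo Fm"
  shows "\<exists>V :: ('k, 'v) module. vectorspace K V \<and> vectorspace.fin_dim K V \<and> witnesses (GL K V) \<Lambda>"
proof -
  let ?D = "BH_category \<Lambda>"
  interpret F: sheaf K ?D Fo Fm by fact
  obtain n where dim: "\<And>\<sigma>. \<sigma> \<in> Obj ?D \<Longrightarrow> vectorspace.fin_dim K (Fo \<sigma>) \<and> vectorspace.dim K (Fo \<sigma>) = n"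
    and invertible: "\<And>l. l \<in> Mor ?D \<Longrightarrow> Lin_invertible K (Fo (ini ?D l)) (Fo (ter ?D l)) (Fm l)"
    and inj: "\<And>\<sigma>. \<sigma> \<in> Obj ?D \<Longrightarrow> inj_on Fm (endos ?D \<sigma>)"
    using dev unfolding dev_properties_def Let_def endos_def[symmetric] by blast
  obtain V :: "('k, 'v) module" where V: "vectorspace K V" "vectorspace.fin_dim K V"
    and V_dim: "\<And>\<sigma>. \<sigma> \<in> Obj ?D \<Longrightarrow> vectorspace.dim K V = n"
  proof (cases "Obj ?D = {}")
    case True
    then show ?thesis using that finite_dimensional_space_exists[OF K] by blast
  next
    case False
    then obtain \<sigma> where "\<sigma> \<in> Obj ?D" by blast
    then show ?thesis using that[of "Fo \<sigma>"] F.vectorspace dim by blast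
  qed
  have "\<exists>f. f \<in> module_hom K (Fo x) V \<and> bij_betw f (carrier (Fo x)) (carrier V)" if "x \<in> Obj ?D" for x
    using equal_dim_imp_isomorphic[of K "Fo x" V] F.vectorspace[OF that] dim[OF that] V V_dim[OF that] by metis
  then obtain f where f: "\<And>x. x \<in> Obj ?D \<Longrightarrow> f x \<in> module_hom K (Fo x) V"
    and f_bij: "\<And>x. x \<in> Obj ?D \<Longrightarrow> bij_betw (f x) (carrier (Fo x)) (carrier V)"
    by metis
  note \<Phi> = functor_of_sheaf[OF V(1) sheaf invertible f f_bij]
  have "group (GL K V)" using V(1) by (simp add: vectorspace_def group_GL)
  then have "witnesses (GL K V) \<Lambda>"
    using \<Phi>(1)
  proof (rule faithful_functor_imp_witnesses)
    fix \<sigma> assume "\<sigma> \<in> Obj C"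
    then have "\<sigma> \<in> Obj ?D" by (simp add: BH_simps C_def)
    then show "inj_on (\<lambda>l. \<lambda>v\<in>carrier V. f (ter ?D l) (Fm l (inv_into (carrier (Fo (ini ?D l))) (f (ini ?D l)) v))) (endos ?D \<sigma>)"
      using \<Phi>(2) inj by blast
  qed
  then show ?thesis using V by blast
qed

theorem theoremA:
  fixes K :: "('k, 'r) ring_scheme"
    and \<Lambda> :: "('o, 'm, 'g) complex_of_groups_data"
  assumes "field K"
    and "complex_of_groups \<Lambda>"
  shows "(\<exists>V :: ('k, 'v) module. vectorspace K V \<and> vectorspace.fin_dim K V \<and> witnesses (GL K V) \<Lambda>)
    \<longleftrightarrow> (\<exists>(Fo :: 'o \<Rightarrow> ('k, 'v) module) Fm.
           sheaf K (BH_category \<Lambda>) Fo Fm \<and> dev_properties K \<Lambda> Fo Fm)"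
  using complex_of_groups.witness_imp_sheaf[OF assms(2)]
    complex_of_groups.sheaf_imp_witness[OF assms(2,1)] by blast

end
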